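(* Let $(R,\mathfrak m,k)$ be a Noetherian local ring, let $M$ be a nonzero finitely generated $R$-module of dimension $D\geq1$, and let $I\subsetneq R$ be an ideal such that $\operatorname{ht}_M(I)>0$. Then, for every $1\leq i\leq D$, $$c^{(1)}\bigl(I^{[i]};M\bigr)=c_i(I;M).$$
   Context: $\lambda_R$ denotes length; $\operatorname{ht}_M(I)$ is the height of the ideal $(I+\operatorname{Ann}_R(M))/\operatorname{Ann}_R(M)$ of $R/\operatorname{Ann}_R(M)$. Multiplicity sequence: put $$\mathscr G(I;M)_{a,b}=\frac{\mathfrak m^aI^bM+I^{b+1}M}{\mathfrak m^{a+1}I^bM+I^{b+1}M},\qquad h_{I,M}(r,u)=\sum_{a=0}^r\sum_{b=0}^u\lambda_R(\mathscr G(I;M)_{a,b}).$$ For $r,u\gg0$ this agrees with a polynomial of total degree at most $D$, whose homogeneous component of degree $D$ is $\sum_{i=0}^{D}\frac{c_i(I;M)}{(D-i)!\,i!}r^{D-i}u^i$; the integers $c_0(I;M),\ldots,c_D(I;M)$ form the multiplicity sequence of $I$ on $M$ (codimension indexing of the Achilles--Manaresi sequence). Directional mixed multiplicities for a single ideal ($s=1$): for $r,u\gg0$ the function $H^{(1)}_{I,M}(r,u)=\lambda_R\bigl(I^uM/(\mathfrak m^{r+1}I^uM+I^{u+1}M)\bigr)$ agrees with a polynomial of total degree at most $D-1$, and the nonnegative integers $c^{(1)}(I^{[i]};M)$, $1\le i\le D$, are defined by the requirement that its homogeneous component of degree $D-1$ (zero if the degree is smaller) is $\sum_{i=1}^{D}\frac{c^{(1)}(I^{[i]};M)}{(D-i)!\,(i-1)!}r^{D-i}u^{i-1}$.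 Here $I^{[i]}$ is repetition notation, not a power. *)

theory Defs
  imports "HOL-Library.Extended_Real" "HOL-Algebra.Module" "HOL-Algebra.Ideal_Product" "HOL-Algebra.Ring_Divisibility"
begin

section \<open>Noetherian local rings, Krull dimension, height\<close>

locale noetherian_local_ring = cring R + noetherian_ring R
  for R (structure) and \<mm> +
  assumes maximal: "maximalideal \<mm> R"
    and unique_maximal: "maximalideal J R \<Longrightarrow> J = \<mm>"

text \<open>Prime chains are \<open>P 0 \<subset> \<dots> \<subset> P n\<close>, of length \<open>n\<close>. Suprema are taken in \<^typ>\<open>enat\<close>, so the
  zero ring gets dimension \<open>0\<close>, and the improper ideal gets height \<open>\<infinity>\<close>.\<close>

definition prime_chain :: "('a, 'c) ring_scheme \<Rightarrow> nat \<Rightarrow> (nat \<Rightarrow> 'a set) \<Rightarrow> bool" where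
  "prime_chain R n P \<longleftrightarrow> (\<forall>i\<le>n. primeideal (P i) R) \<and> (\<forall>i<n. P i \<subset> P (Suc i))"

definition krull_dim :: "('a, 'c) ring_scheme \<Rightarrow> enat" where
  "krull_dim R = (SUP n \<in> {n. \<exists>P. prime_chain R n P}. enat n)"

definition prime_height :: "('a, 'c) ring_scheme \<Rightarrow> 'a set \<Rightarrow> enat" where
  "prime_height R \<pp> = (SUP n \<in> {n. \<exists>P. prime_chain R n P \<and> P n = \<pp>}. enat n)"

definition ideal_height :: "('a, 'c) ring_scheme \<Rightarrow> 'a set \<Rightarrow> enat" where
  "ideal_height R I = (INF \<pp> \<in> {\<pp>. primeideal \<pp> R \<and> I \<subseteq> \<pp>}. prime_height R \<pp>)"


section \<open>Modules\<close>

definition annihilator :: "('a, 'c) ring_scheme \<Rightarrow> ('a, 'b, 'd) module_scheme \<Rightarrow> 'a set" where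
  "annihilator R M = {a \<in> carrier R. \<forall>x \<in> carrier M. a \<odot>\<^bsub>M\<^esub> x = \<zero>\<^bsub>M\<^esub>}"

definition module_dim :: "('a, 'c) ring_scheme \<Rightarrow> ('a, 'b, 'd) module_scheme \<Rightarrow> enat" where
  "module_dim R M = krull_dim (R Quot annihilator R M)"

definition module_height ::
    "('a, 'c) ring_scheme \<Rightarrow> ('a, 'b, 'd) module_scheme \<Rightarrow> 'a set \<Rightarrow> enat" where
  "module_height R M I =
     ideal_height (R Quot annihilator R M)
       ((\<lambda>x. annihilator R M +>\<^bsub>R\<^esub> x) ` (I <+>\<^bsub>R\<^esub> annihilator R M))"

definition generated_submodule ::
    "('a, 'c) ring_scheme \<Rightarrow> ('a, 'b, 'd) module_scheme \<Rightarrow> 'b set \<Rightarrow> 'b set" where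
  "generated_submodule R M S = \<Inter> {H. submodule H R M \<and> S \<subseteq> H}"

definition finitely_generated_module ::
    "('a, 'c) ring_scheme \<Rightarrow> ('a, 'b, 'd) module_scheme \<Rightarrow> bool" where
  "finitely_generated_module R M \<longleftrightarrow>
     (\<exists>A \<subseteq> carrier M. finite A \<and> generated_submodule R M A = carrier M)"

definition ideal_times ::
    "('a, 'c) ring_scheme \<Rightarrow> ('a, 'b, 'd) module_scheme \<Rightarrow> 'a set \<Rightarrow> 'b set \<Rightarrow> 'b set" where
  "ideal_times R M J N = generated_submodule R M {a \<odot>\<^bsub>M\<^esub> x | a x. a \<in> J \<and> x \<in> N}"

abbreviation ideal_power :: "('a, 'c) ring_scheme \<Rightarrow> 'a set \<Rightarrow> nat \<Rightarrow> 'a set" where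
  "ideal_power R J n \<equiv> J [^]\<^bsub>ideals_set R\<^esub> n"

text \<open>The quotient \<open>M/N\<close>, in the style of \<^const>\<open>FactRing\<close>. The fields \<open>mult\<close> and \<open>one\<close> of a module
  record play no role for modules.\<close>

definition quotient_module ::
    "('a, 'b, 'd) module_scheme \<Rightarrow> 'b set \<Rightarrow> ('a, 'b set) module" where
  "quotient_module M N =
     \<lparr>carrier = a_rcosets\<^bsub>M\<^esub> N, monoid.mult = undefined, one = undefined, zero = N, add = set_add M,
      smult = (\<lambda>a C. \<Union>x\<in>C. N +>\<^bsub>M\<^esub> (a \<odot>\<^bsub>M\<^esub> x))\<rparr>"

definition module_length :: "('a, 'c) ring_scheme \<Rightarrow> ('a, 'b, 'd) module_scheme \<Rightarrow> enat" where
  "module_length R M =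
     (SUP n \<in> {n. \<exists>N. (\<forall>i\<le>n. submodule (N i) R M) \<and> (\<forall>i<n. N i \<subset> N (Suc i))}. enat n)"

text \<open>The length of \<open>N/L\<close> for submodules \<open>L \<subseteq> N\<close> of \<open>M\<close>.\<close>

definition quotient_length ::
    "('a, 'c) ring_scheme \<Rightarrow> ('a, 'b, 'd) module_scheme \<Rightarrow> 'b set \<Rightarrow> 'b set \<Rightarrow> enat" where
  "quotient_length R M N L = module_length R (quotient_module (M\<lparr>carrier := N\<rparr>) L)"


section \<open>Multiplicity sequence and directional mixed multiplicities\<close>

text \<open>For \<open>r, u \<ggreater> 0\<close> the values \<open>F r u\<close> are finite and equal to those of the polynomial of total
  degree at most \<open>d\<close> whose coefficient of \<open>r\<^sup>a u\<^sup>b\<close> is \<open>p a b\<close>.\<close>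

definition eventually_polynomial ::
    "(nat \<Rightarrow> nat \<Rightarrow> enat) \<Rightarrow> nat \<Rightarrow> (nat \<Rightarrow> nat \<Rightarrow> real) \<Rightarrow> bool" where
  "eventually_polynomial F d p \<longleftrightarrow>
     (\<exists>n0. \<forall>r\<ge>n0. \<forall>u\<ge>n0.
        ereal_of_enat (F r u) = ereal (\<Sum>a\<le>d. \<Sum>b\<le>d - a. p a b * real r ^ a * real u ^ b))"

definition bigraded_length ::
    "('a, 'c) ring_scheme \<Rightarrow> 'a set \<Rightarrow> ('a, 'b, 'd) module_scheme \<Rightarrow> 'a set \<Rightarrow> nat \<Rightarrow> nat \<Rightarrow> enat" where
  "bigraded_length R \<mm> M I a b =
     (let IM = (\<lambda>n. ideal_times R M (ideal_power R I n) (carrier M));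
          mIM = (\<lambda>n. ideal_times R M (ideal_power R \<mm> n) (IM b))
      in quotient_length R M (mIM a <+>\<^bsub>M\<^esub> IM (b + 1)) (mIM (a + 1) <+>\<^bsub>M\<^esub> IM (b + 1)))"

definition bigraded_hilbert_sum ::
    "('a, 'c) ring_scheme \<Rightarrow> 'a set \<Rightarrow> ('a, 'b, 'd) module_scheme \<Rightarrow> 'a set \<Rightarrow> nat \<Rightarrow> nat \<Rightarrow> enat" where
  "bigraded_hilbert_sum R \<mm> M I r u = (\<Sum>a=0..r. \<Sum>b=0..u. bigraded_length R \<mm> M I a b)"

definition directional_hilbert ::
    "('a, 'c) ring_scheme \<Rightarrow> 'a set \<Rightarrow> ('a, 'b, 'd) module_scheme \<Rightarrow> 'a set \<Rightarrow> nat \<Rightarrow> nat \<Rightarrow> enat" where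
  "directional_hilbert R \<mm> M I r u =
     (let IM = (\<lambda>n. ideal_times R M (ideal_power R I n) (carrier M))
      in quotient_length R M (IM u)
           (ideal_times R M (ideal_power R \<mm> (r + 1)) (IM u) <+>\<^bsub>M\<^esub> IM (u + 1)))"

text \<open>Both sequences are set to \<open>0\<close> outside their index range, so that the defining
  requirement determines them uniquely.\<close>

definition multiplicity_sequence ::
    "('a, 'c) ring_scheme \<Rightarrow> 'a set \<Rightarrow> ('a, 'b, 'd) module_scheme \<Rightarrow> 'a set \<Rightarrow> nat \<Rightarrow> int" where
  "multiplicity_sequence R \<mm> M I =
     (let D = the_enat (module_dim R M) in
      THE c. (\<forall>i. i \<notin> {0..D} \<longrightarrow> c i = 0) \<and>
        (\<exists>p. eventually_polynomial (bigraded_hilbert_sum R \<mm> M I) D p \<and>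
          (\<forall>i\<in>{0..D}. p (D - i) i = of_int (c i) / (fact (D - i) * fact i))))"

definition directional_multiplicity ::
    "('a, 'c) ring_scheme \<Rightarrow> 'a set \<Rightarrow> ('a, 'b, 'd) module_scheme \<Rightarrow> 'a set \<Rightarrow> nat \<Rightarrow> int" where
  "directional_multiplicity R \<mm> M I =
     (let D = the_enat (module_dim R M) in
      THE c. (\<forall>i. i \<notin> {1..D} \<longrightarrow> c i = 0) \<and>
        (\<exists>p. eventually_polynomial (directional_hilbert R \<mm> M I) (D - 1) p \<and>
          (\<forall>i\<in>{1..D}. p (D - i) (i - 1) = of_int (c i) / (fact (D - i) * fact (i - 1)))))"

end

theory Submission
  imports Defs "HOL-Computational_Algebra.Polynomial" "HOL-Library.List_Lexorder"
begin

text \<open>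
  Write \<open>h(r,u)\<close> for the sum transform of the bigraded lengths and \<open>H(r,u)\<close> for the directional Hilbert
  function. For fixed \<open>b\<close> the modules \<open>\<mm>\<^sup>a I\<^sup>b M + I\<^sup>b\<^sup>+\<^sup>1 M\<close> descend from \<open>I\<^sup>b M\<close>, so additivity of length makes
  the sum over \<open>a \<le> r\<close> telescope to \<open>H(r,b)\<close>, and \<open>h(r,u)\<close> is the sum of \<open>H(r,b)\<close> over \<open>b \<le> u\<close>. Thus
  \<open>H(r,u) = h(r,u) - h(r,u-1)\<close> for \<open>u \<ge> 1\<close>, and a backward difference in \<open>u\<close> turns a term
  \<open>c r\<^sup>D\<^sup>-\<^sup>i u\<^sup>i / ((D-i)! i!)\<close> into \<open>c r\<^sup>D\<^sup>-\<^sup>i u\<^sup>i\<^sup>-\<^sup>1 / ((D-i)! (i-1)!)\<close> plus terms of smaller degree. Hence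
  every polynomial for \<open>h\<close> gives one for \<open>H\<close> with the same leading numbers for \<open>i \<ge> 1\<close>.

  Both sequences are definite descriptions, so their equality calls for the converse as well: a polynomial
  for \<open>H\<close> must give one for \<open>h\<close>, together with an integer \<open>c\<^sub>0\<close>. Then the two descriptions have solutions
  under the same circumstances, and the solutions agree at every \<open>i \<ge> 1\<close>; when there is no solution, both
  descriptions denote the same unspecified sequence. Summation in \<open>u\<close> recovers \<open>h(r,u)\<close> from \<open>H\<close> up to
  \<open>h(r,N)\<close> for one fixed \<open>N\<close>, a finite sum of functions \<open>H(r,b)\<close> of \<open>r\<close> alone. So it suffices that for
  each \<open>b\<close> the function \<open>H(r,b)\<close> is finite and, for large \<open>r\<close>, a polynomial in \<open>r\<close> of degree at most \<open>D\<close>;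
  that \<open>c\<^sub>0\<close> is an integer follows because a polynomial with integer values has an integer \<open>D\<close>-th
  difference. This reduction is the lemma \<open>leading_sequences_agree\<close>.

  The function \<open>H(r,b)\<close> of \<open>r\<close> is the Hilbert--Samuel function of \<open>I\<^sup>b M / I\<^sup>b\<^sup>+\<^sup>1 M\<close>, treated in
  \<open>hilbert_samuel_polynomial\<close> by two independent arguments, inside \<open>M\<close> and with lengths of chains of submodules.

  Polynomiality: choose generators \<open>x\<^sub>1, \<dots>, x\<^sub>t\<close> of \<open>\<mm>\<close> and \<open>z\<^sub>1, \<dots>, z\<^sub>k\<close> of the module. The length of a layer of
  the \<open>\<mm>\<close>-adic filtration is the number of standard monomials, those \<open>x\<^sup>e z\<^sub>j\<close> outside the span of the
  smaller ones of the same degree and the next layer. The exponents of the nonstandard ones are closed under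
  increasing an entry, and the number of exponents of degree \<open>n\<close> outside such a set is eventually a
  polynomial in \<open>n\<close>, since ascending chains of such sets are stationary (Dickson's lemma).

  Degree: by Noetherian induction on an ideal \<open>J\<close> the lengths for a cyclic module killed by \<open>J\<close> grow at most
  like \<open>n\<^sup>d\<close>, where \<open>d\<close> bounds the length of chains of primes above \<open>J\<close> (\<open>cyclic_length_growth\<close>). If
  \<open>a b \<in> J\<close> with \<open>a, b \<notin> J\<close>, the module is an extension of modules killed by \<open>J + (a)\<close> and by \<open>(J : a)\<close>.
  If \<open>J\<close> is prime and \<open>x \<in> \<mm> - J\<close>, multiplication by \<open>x\<close> compares the lengths at \<open>n\<close> and \<open>n + 1\<close> up to a
  module killed by \<open>J + (x)\<close>, above which chains of primes are shorter.
\<close>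

section \<open>Differences and sums of polynomials\<close>

definition backward_diff :: "real poly \<Rightarrow> real poly" where
  "backward_diff p = p - pcompose p [:- 1, 1:]"

lemma poly_backward_diff: "poly (backward_diff p) x = poly p x - poly p (x - 1)"
  by (simp add: backward_diff_def poly_pcompose)

lemma backward_diff_add: "backward_diff (p + q) = backward_diff p + backward_diff q"
  by (simp add: backward_diff_def pcompose_add)

lemma coeff_pcompose_shift:
  assumes "degree (q :: real poly) \<le> d"
  shows "Polynomial.coeff (pcompose q [:- 1, 1:]) d = Polynomial.coeff q d"
proof (cases "degree q = d")
  case True
  then show ?thesis using lead_coeff_comp[of "[:- 1, 1:]" q] by (simp add: degree_pcompose)
next
  case False
  then show ?thesis using assms by (simp add: coeff_eq_0 degree_pcompose)
qed

text \<open>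
  Writing \<open>p = a + X q\<close> gives \<open>\<Delta> p = X \<Delta> q + q(X - 1)\<close>, from which both claims follow by induction on the degree.
  The bound \<open>d\<close> may exceed the true degree, in which case both coefficients vanish.
\<close>

lemma backward_diff_leading:
  assumes "degree p \<le> Suc d"
  shows "degree (backward_diff p) \<le> d \<and>
    Polynomial.coeff (backward_diff p) d = real (Suc d) * Polynomial.coeff p (Suc d)"
  using assms
proof (induction d arbitrary: p)
  case 0
  obtain a q where p: "p = pCons a q" by (cases p)
  with 0 have "degree q = 0" by (auto split: if_splits)
  then obtain b where "q = [:b:]" by (auto elim: degree_eq_zeroE)
  then have "backward_diff p = [:b:]"
    by (simp add: p backward_diff_def pcompose_pCons)
  then show ?case using \<open>q = [:b:]\<close> by (simp add: p)
next
  case (Suc d)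
  obtain a q where p: "p = pCons a q" by (cases p)
  have q: "degree q \<le> Suc d" using Suc.prems p by (auto split: if_splits)
  have eq: "backward_diff p = pCons 0 (backward_diff q) + pcompose q [:- 1, 1:]"
    by (simp add: p backward_diff_def pcompose_pCons)
  have IH: "degree (backward_diff q) \<le> d"
    "Polynomial.coeff (backward_diff q) d = real (Suc d) * Polynomial.coeff q (Suc d)"
    using Suc.IH[OF q] by auto
  have "degree (pCons 0 (backward_diff q)) \<le> Suc d" using IH by (simp add: degree_pCons_le le_trans)
  moreover have "degree (pcompose q [:- 1, 1:]) \<le> Suc d" using q by (simp add: degree_pcompose)
  ultimately show ?case
    unfolding eq using IH q coeff_pcompose_shift[OF q]
    by (auto intro: degree_add_le simp: p algebra_simps)
qed

text \<open>
  Every polynomial can be summed: a monomial of one degree more, suitably scaled, cancels the leading term.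
\<close>

lemma backward_diff_surj:
  assumes "degree p \<le> d"
  shows "\<exists>s. degree s \<le> Suc d \<and> backward_diff s = p"
  using assms
proof (induction d arbitrary: p)
  case 0
  then obtain c where "p = [:c:]" by (auto elim: degree_eq_zeroE)
  then have "backward_diff [:0, c:] = p" by (simp add: backward_diff_def pcompose_pCons)
  then show ?case by (intro exI[of _ "[:0, c:]"]) simp
next
  case (Suc d)
  define s0 where "s0 = Polynomial.monom (Polynomial.coeff p (Suc d) / real (Suc (Suc d))) (Suc (Suc d))"
  have s0: "degree s0 \<le> Suc (Suc d)" by (simp add: s0_def degree_monom_le)
  define q where "q = p - backward_diff s0"
  have "degree q \<le> Suc d" "Polynomial.coeff q (Suc d) = 0"
    using backward_diff_leading[OF s0] Suc.prems
    by (auto simp: q_def s0_def intro!: degree_diff_le)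
  then have "degree q \<le> d"
    by (metis degree_le le_Suc_eq leading_coeff_0_iff le_zero_eq degree_0 zero_le)
  then obtain s1 where s1: "degree s1 \<le> Suc d" "backward_diff s1 = q" using Suc.IH by blast
  have "backward_diff (s0 + s1) = p" using s1 by (simp add: backward_diff_add q_def)
  moreover have "degree (s0 + s1) \<le> Suc (Suc d)" using s0 s1 by (intro degree_add_le) auto
  ultimately show ?case by blast
qed

lemma poly_eq_sum_coeffs:
  fixes p :: "real poly"
  assumes "degree p \<le> d" shows "poly p x = (\<Sum>i\<le>d. Polynomial.coeff p i * x ^ i)"
  using arg_cong[OF poly_as_sum_of_monoms'[OF assms], of "\<lambda>q. poly q x"]
  by (simp add: poly_sum poly_monom)

lemma poly_eqI_large:
  assumes "\<And>n. n \<ge> N \<Longrightarrow> poly p (real n) = poly q (real n)"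
  shows "p = q"
proof (rule ccontr)
  assume "p \<noteq> q"
  then have "finite {x. poly (p - q) x = 0}" by (intro poly_roots_finite) simp
  moreover have "real ` {N..} \<subseteq> {x. poly (p - q) x = 0}" using assms by auto
  ultimately have "finite (real ` {N..})" by (rule finite_subset[rotated])
  then have "finite {N..}" by (rule finite_imageD) (simp add: inj_on_def)
  then show False using infinite_Ici by blast
qed

text \<open>
  The left-hand side is the \<open>d\<close>-th difference of \<open>p\<close>, a combination of integer values.
\<close>

lemma integer_valued_poly_coeff:
  assumes "degree p \<le> d" and "\<And>n. n \<ge> N \<Longrightarrow> poly p (real n) \<in> \<int>"
  shows "fact d * Polynomial.coeff p d \<in> \<int>"
  using assms
proof (induction d arbitrary: p N)
  case 0
  then obtain c where "p = [:c:]" by (auto elim: degree_eq_zeroE)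
  then show ?case using "0.prems"(2)[of N] by simp
next
  case (Suc d)
  note * = backward_diff_leading[OF Suc.prems(1)]
  have "poly (backward_diff p) (real n) \<in> \<int>" if "n \<ge> Suc N" for n
    using Suc.prems(2)[of n] Suc.prems(2)[of "n - 1"] that
    by (auto simp: poly_backward_diff of_nat_diff)
  then have "fact d * Polynomial.coeff (backward_diff p) d \<in> \<int>" using Suc.IH[of "backward_diff p" "Suc N"] * by blast
  then show ?case using * by (simp add: algebra_simps)
qed

text \<open>
  Suppose the degree were larger. With a negative leading coefficient \<open>p\<close> would tend to \<open>-\<infinity>\<close>, and with a positive
  one \<open>p - C (X + 1)\<^sup>d\<close> would tend to \<open>\<infinity>\<close>.
\<close>

lemma poly_degree_le_growth:
  assumes "\<And>n. n \<ge> N \<Longrightarrow> 0 \<le> poly p (real n)" "\<And>n. n \<ge> N \<Longrightarrow> poly p (real n) \<le> C * real (Suc n) ^ d"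
  shows "degree p \<le> d"
proof (rule ccontr)
  assume neg: "\<not> degree p \<le> d"
  define q where "q = p - Polynomial.smult C ([:1, 1:] ^ d)"
  have dq: "degree (Polynomial.smult C ([:1, 1:] ^ d)) \<le> d"
    by (metis degree_smult_le degree_linear_power order_refl degree_power_eq le_trans)
  have "degree q = degree p"
    unfolding q_def using dq neg degree_add_eq_left[of "- Polynomial.smult C ([:1, 1:] ^ d)" p] by simp
  moreover have "Polynomial.coeff (Polynomial.smult C ([:1, 1:] ^ d)) (degree p) = 0"
    by (rule coeff_eq_0) (use dq neg in linarith)
  then have "Polynomial.coeff q (degree p) = lead_coeff p"
    by (simp add: q_def del: coeff_smult)
  ultimately have lcq: "lead_coeff q = lead_coeff p" "degree q = degree p" by simp_all
  have big: "\<exists>n\<ge>N. poly r (real n) \<ge> lead_coeff r" if "lead_coeff r > 0" for r :: "real poly"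
  proof -
    from poly_pinfty_gt_lc[OF that] obtain x0 where "\<forall>x\<ge>x0. poly r x \<ge> lead_coeff r" by blast
    moreover have "real (max N (nat \<lceil>x0\<rceil>)) \<ge> x0" by linarith
    ultimately show ?thesis by (intro exI[of _ "max N (nat \<lceil>x0\<rceil>)"]) auto
  qed
  have "p \<noteq> 0" using neg by auto
  then consider "lead_coeff p > 0" | "lead_coeff (- p) > 0"
    by (metis leading_coeff_0_iff linorder_neqE_linordered_idom coeff_minus degree_minus neg_0_less_iff_less)
  then show False
  proof cases
    case 1
    then obtain n where "n \<ge> N" "poly q (real n) \<ge> lead_coeff q" using big[of q] lcq by auto
    then show False using assms(2)[of n] 1 lcq by (auto simp: q_def)
  next
    case 2
    then obtain n where "n \<ge> N" "poly (- p) (real n) \<ge> lead_coeff (- p)" using big by blast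
    then show False using assms(1)[of n] 2 by auto
  qed
qed

section \<open>Eventually polynomial sequences\<close>

definition eventually_poly :: "(nat \<Rightarrow> real) \<Rightarrow> bool" where
  "eventually_poly f \<longleftrightarrow> (\<exists>p N. \<forall>n\<ge>N. f n = poly p (real n))"

lemma eventually_polyI: "(\<And>n. n \<ge> N \<Longrightarrow> f n = poly p (real n)) \<Longrightarrow> eventually_poly f"
  by (auto simp: eventually_poly_def)

lemma eventually_poly_cong:
  assumes "eventually_poly f" "\<And>n. n \<ge> N \<Longrightarrow> g n = f n" shows "eventually_poly g"
proof -
  obtain p N' where "\<forall>n\<ge>N'. f n = poly p (real n)" using assms(1) by (auto simp: eventually_poly_def)
  then show ?thesis using assms(2) by (intro eventually_polyI[of "max N N'" _ p]) auto
qed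

lemma eventually_poly_add:
  assumes "eventually_poly f" "eventually_poly g" shows "eventually_poly (\<lambda>n. f n + g n)"
proof -
  obtain p N q N' where "\<forall>n\<ge>N. f n = poly p (real n)" "\<forall>n\<ge>N'. g n = poly q (real n)"
    using assms by (auto simp: eventually_poly_def)
  then show ?thesis by (intro eventually_polyI[of "max N N'" _ "p + q"]) auto
qed

lemma eventually_poly_sum:
  assumes "\<And>k. k \<in> A \<Longrightarrow> eventually_poly (f k)"
  shows "eventually_poly (\<lambda>n. \<Sum>k\<in>A. f k n)"
proof (cases "finite A")
  case True
  then show ?thesis using assms
    by (induction A) (auto intro: eventually_poly_add eventually_polyI[of 0 _ 0])
qed (auto intro: eventually_polyI[of 0 _ 0])

lemma eventually_poly_shift:
  assumes "eventually_poly f" shows "eventually_poly (\<lambda>n. f (n - k))"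
proof -
  obtain p N where "\<forall>n\<ge>N. f n = poly p (real n)" using assms by (auto simp: eventually_poly_def)
  then show ?thesis
    by (intro eventually_polyI[of "N + k" _ "pcompose p [:- real k, 1:]"])
      (auto simp: poly_pcompose of_nat_diff)
qed

lemma eventually_poly_shift_left:
  assumes "eventually_poly f" shows "eventually_poly (\<lambda>n. f (n + k))"
proof -
  obtain p N where "\<forall>n\<ge>N. f n = poly p (real n)" using assms by (auto simp: eventually_poly_def)
  then show ?thesis
    by (intro eventually_polyI[of N _ "pcompose p [:real k, 1:]"]) (auto simp: poly_pcompose add.commute)
qed

lemma eventually_poly_partial_sums:
  assumes "eventually_poly f" shows "eventually_poly (\<lambda>n. \<Sum>i<n. f i)"
proof -
  obtain p N where f: "\<forall>n\<ge>N. f n = poly p (real n)" using assms by (auto simp: eventually_poly_def)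
  obtain s where s: "backward_diff s = p" using backward_diff_surj[OF order_refl] by blast
  define c where "c = (\<Sum>i<N. f i) - poly s (real N - 1)"
  have "(\<Sum>i<n. f i) = c + poly s (real n - 1)" if "n \<ge> N" for n
    using that
  proof (induction n rule: dec_induct)
    case (step n)
    then show ?case using f poly_backward_diff[of s "real n"] by (simp add: s)
  qed (simp add: c_def)
  then show ?thesis
    by (intro eventually_polyI[of N _ "[:c:] + pcompose s [:- 1, 1:]"]) (simp add: poly_pcompose)
qed

section \<open>Counting the exponents outside an up-closed set\<close>

text \<open>
  Lists of length \<open>t\<close> are exponents of monomials in \<open>t\<close> variables, and such a set is the set of exponents of a
  monomial ideal.
\<close>

definition up_closed :: "nat \<Rightarrow> nat list set \<Rightarrow> bool" where
  "up_closed t U \<longleftrightarrow> (\<forall>es\<in>U. length es = t \<and> (\<forall>i<t. es[i := Suc (es ! i)] \<in> U))"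

definition slice :: "nat \<Rightarrow> nat list set \<Rightarrow> nat list set" where
  "slice k U = {es. k # es \<in> U}"

definition complement_count :: "nat \<Rightarrow> nat list set \<Rightarrow> nat \<Rightarrow> nat" where
  "complement_count t U n = card {es. length es = t \<and> sum_list es = n \<and> es \<notin> U}"

lemma up_closed_slice: "up_closed (Suc t) U \<Longrightarrow> up_closed t (slice k U)"
  unfolding up_closed_def slice_def
  by (auto, metis Suc_less_eq length_Cons list_update_code(3) nth_Cons_Suc)

lemma slice_mono:
  assumes "up_closed (Suc t) U" "k \<le> l" shows "slice k U \<subseteq> slice l U"
  using assms(2)
proof (induction l rule: dec_induct)
  case (step l)
  have "slice l U \<subseteq> slice (Suc l) U"
  proof
    fix es assume "es \<in> slice l U"
    then have "(l # es)[0 := Suc ((l # es) ! 0)] \<in> U" using assms(1) unfolding up_closed_def slice_def by blast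
    then show "es \<in> slice (Suc l) U" by (simp add: slice_def)
  qed
  then show ?case using step.IH by blast
qed simp

lemma slice_ext:
  assumes "up_closed (Suc t) U" "up_closed (Suc t) V" "\<And>k. slice k U = slice k V" shows "U = V"
proof -
  have "es \<in> U \<longleftrightarrow> es \<in> V" if "length es = Suc t" for es
    using assms(3)[of "hd es"] that by (cases es) (auto simp: slice_def)
  then show ?thesis using assms(1,2) unfolding up_closed_def by blast
qed

text \<open>
  Dickson's lemma, in the form of the ascending chain condition. The slices of \<open>V i\<close> at \<open>k\<close> grow with both \<open>i\<close>
  and \<open>k\<close>, so from some \<open>N\<close> on the diagonal sequence is constant; this settles all slices beyond \<open>N\<close>, and the
  remaining ones are finitely many chains in one variable less.
\<close>

lemma up_closed_chain_stabilises:
  fixes V :: "nat \<Rightarrow> nat list set"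
  assumes "\<And>i. up_closed t (V i)" "mono V"
  shows "\<exists>N. \<forall>i\<ge>N. V i = V N"
  using assms
proof (induction t arbitrary: V)
  case 0
  have V: "V i \<subseteq> {[]}" for i using "0.prems"(1)[of i] by (auto simp: up_closed_def)
  show ?case
  proof (cases "\<exists>N. [] \<in> V N")
    case True
    then obtain N where "[] \<in> V N" by blast
    then have "V i = {[]}" if "i \<ge> N" for i using V[of i] monoD[OF "0.prems"(2) that] by blast
    then show ?thesis by (metis order_refl)
  next
    case False
    then have "V i = {}" for i using V[of i] by blast
    then show ?thesis by simp
  qed
next
  case (Suc t)
  have mono_slice: "slice k (V i) \<subseteq> slice l (V j)" if "k \<le> l" "i \<le> j" for i j k l
    using slice_mono[OF Suc.prems(1)[of i] that(1)] monoD[OF Suc.prems(2) that(2)]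
    by (auto simp: slice_def)
  have upc: "up_closed t (slice k (V i))" for k i using up_closed_slice Suc.prems(1) by blast
  have "\<exists>N. \<forall>i\<ge>N. slice i (V i) = slice N (V N)"
    using Suc.IH[of "\<lambda>i. slice i (V i)"] upc mono_slice by (simp add: mono_def)
  then obtain N where N: "\<And>i. i \<ge> N \<Longrightarrow> slice i (V i) = slice N (V N)" by blast
  have "\<forall>k. \<exists>M. \<forall>i\<ge>M. slice k (V i) = slice k (V M)"
    using Suc.IH[of "\<lambda>i. slice _ (V i)"] upc mono_slice by (simp add: mono_def)
  then obtain M where M: "\<And>k i. i \<ge> M k \<Longrightarrow> slice k (V i) = slice k (V (M k))" by metis
  \<comment> \<open>Beyond \<open>B\<close> the diagonal and each of the finitely many slices up to \<open>N\<close> are constant.\<close>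
  define B where "B = Max (insert N (M ` {..N}))"
  have BN: "B \<ge> N" unfolding B_def by (rule Max_ge) auto
  have BM: "B \<ge> M k" if "k \<le> N" for k unfolding B_def using that by (intro Max_ge) auto
  have "V i = V B" if "i \<ge> B" for i
  proof (rule slice_ext[OF Suc.prems(1) Suc.prems(1)])
    fix k
    show "slice k (V i) = slice k (V B)"
    proof (cases "k \<le> N")
      case True
      then show ?thesis using M[of k i] M[of k B] BM[of k] that by simp
    next
      case False
      have "slice k (V j) = slice N (V N)" if "j \<ge> N" for j
      proof
        show "slice k (V j) \<subseteq> slice N (V N)"
          using mono_slice[of k "max k j" j "max k j"] N[of "max k j"] that by simp
        show "slice N (V N) \<subseteq> slice k (V j)" using mono_slice[of N k N j] that False by simp
      qed
      then show ?thesis using BN that by simp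
    qed
  qed
  then show ?case by blast
qed

lemma finite_lists_sum: "finite {es :: nat list. length es = t \<and> sum_list es = n}"
proof (rule finite_subset)
  show "{es. length es = t \<and> sum_list es = n} \<subseteq> {es. set es \<subseteq> {..n} \<and> length es = t}"
    using member_le_sum_list by fastforce
  show "finite {es. set es \<subseteq> {..n} \<and> length es = t}" using finite_lists_length_eq[of "{..n}" t] by simp
qed

lemma complement_count_slices:
  "complement_count (Suc t) U n = (\<Sum>k\<le>n. complement_count t (slice k U) (n - k))"
proof -
  let ?S = "\<lambda>k. {es. length es = t \<and> sum_list es = n - k \<and> es \<notin> slice k U}"
  have fin: "finite (?S k)" for k
    by (rule finite_subset[OF _ finite_lists_sum[of t "n - k"]]) auto
  have "{es. length es = Suc t \<and> sum_list es = n \<and> es \<notin> U} = (\<Union>k\<in>{..n}. (#) k ` ?S k)"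
    by (auto simp: length_Suc_conv slice_def image_iff)
  then have "complement_count (Suc t) U n = card (\<Union>k\<in>{..n}. (#) k ` ?S k)"
    by (simp add: complement_count_def)
  also have "\<dots> = (\<Sum>k\<le>n. card ((#) k ` ?S k))"
    using fin by (intro card_UN_disjoint) auto
  also have "\<dots> = (\<Sum>k\<le>n. complement_count t (slice k U) (n - k))"
    by (intro sum.cong refl) (simp add: card_image complement_count_def)
  finally show ?thesis .
qed

text \<open>
  The slices of \<open>U\<close> are constant from some \<open>K\<close> on. The first \<open>K\<close> slices contribute shifted counts in one variable
  less, and all the others together contribute partial sums of one such count.
\<close>

theorem complement_count_eventually_poly:
  assumes "up_closed t U"
  shows "eventually_poly (\<lambda>n. real (complement_count t U n))"
  using assms
proof (induction t arbitrary: U)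
  case 0
  have "complement_count 0 U n = 0" if "n \<ge> 1" for n
    using that by (auto simp: complement_count_def card_eq_0_iff)
  then show ?case by (intro eventually_polyI[of 1 _ 0]) simp
next
  case (Suc t)
  obtain K where K: "\<And>k. k \<ge> K \<Longrightarrow> slice k U = slice K U"
    using up_closed_chain_stabilises[of t "\<lambda>k. slice k U"] up_closed_slice[OF Suc.prems]
      slice_mono[OF Suc.prems] by (auto simp: mono_def)
  let ?c = "\<lambda>k n. real (complement_count t (slice k U) n)"
  have ep: "eventually_poly (?c k)" for k using Suc.IH up_closed_slice[OF Suc.prems] by blast
  have eq: "real (complement_count (Suc t) U n) = (\<Sum>k<K. ?c k (n - k)) + (\<Sum>i<Suc n - K. ?c K i)"
    if "n \<ge> K" for n
  proof -
    have "{..n} = {..<K} \<union> {K..n}" using that by auto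
    then have "(\<Sum>k\<le>n. ?c k (n - k)) = (\<Sum>k<K. ?c k (n - k)) + (\<Sum>k\<in>{K..n}. ?c k (n - k))"
      by (simp add: sum.union_disjoint ivl_disj_int)
    also have "(\<Sum>k\<in>{K..n}. ?c k (n - k)) = (\<Sum>k\<in>{K..n}. ?c K (n - k))"
      by (intro sum.cong refl) (metis K atLeastAtMost_iff)
    also have "\<dots> = (\<Sum>i<Suc n - K. ?c K i)"
      using that by (intro sum.reindex_bij_witness[of _ "\<lambda>i. n - i" "\<lambda>k. n - k"]) auto
    finally show ?thesis by (simp add: complement_count_slices)
  qed
  have "eventually_poly (\<lambda>n. \<Sum>i<Suc n - K. ?c K i)"
    using eventually_poly_shift_left[OF eventually_poly_shift[OF eventually_poly_partial_sums[OF ep]], of _ 1 K] by simp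
  moreover have "eventually_poly (\<lambda>n. \<Sum>k<K. ?c k (n - k))"
    by (intro eventually_poly_sum eventually_poly_shift ep)
  ultimately have "eventually_poly (\<lambda>n. (\<Sum>k<K. ?c k (n - k)) + (\<Sum>i<Suc n - K. ?c K i))"
    by (rule eventually_poly_add[rotated])
  then show ?case by (rule eventually_poly_cong[of _ K]) (rule eq)
qed

section \<open>Bivariate polynomials with coefficients in one variable\<close>

text \<open>
  A polynomial in \<open>r\<close> and \<open>u\<close> of total degree at most \<open>d\<close> is stored as the family of its coefficients
  \<open>P a\<close> of \<open>r\<^sup>a\<close>, which are polynomials in \<open>u\<close>. Differences and sums in \<open>u\<close> then act on each \<open>P a\<close> separately.
\<close>

definition bivariate_rows :: "(nat \<Rightarrow> nat \<Rightarrow> real) \<Rightarrow> nat \<Rightarrow> (nat \<Rightarrow> real poly) \<Rightarrow> bool" where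
  "bivariate_rows F d P \<longleftrightarrow> (\<forall>a\<le>d. degree (P a) \<le> d - a) \<and>
     (\<exists>N. \<forall>r\<ge>N. \<forall>u\<ge>N. F r u = (\<Sum>a\<le>d. poly (P a) (real u) * real r ^ a))"

lemma bivariate_rows_unique:
  assumes "bivariate_rows F d P" "bivariate_rows F d Q" "a \<le> d"
  shows "P a = Q a"
proof -
  obtain N where P: "\<And>r u. r \<ge> N \<Longrightarrow> u \<ge> N \<Longrightarrow> F r u = (\<Sum>a\<le>d. poly (P a) (real u) * real r ^ a)"
    using assms(1) unfolding bivariate_rows_def by blast
  obtain K where Q: "\<And>r u. r \<ge> K \<Longrightarrow> u \<ge> K \<Longrightarrow> F r u = (\<Sum>a\<le>d. poly (Q a) (real u) * real r ^ a)"
    using assms(2) unfolding bivariate_rows_def by blast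
  show ?thesis
  proof (rule poly_eqI_large[of "max N K"])
    fix u assume u: "u \<ge> max N K"
    define p q where "p = (\<Sum>a\<le>d. Polynomial.monom (poly (P a) (real u)) a)"
      and "q = (\<Sum>a\<le>d. Polynomial.monom (poly (Q a) (real u)) a)"
    have "p = q"
      using u by (intro poly_eqI_large[of "max N K"]) (simp add: p_def q_def poly_sum poly_monom P[symmetric] Q[symmetric])
    then have "Polynomial.coeff p a = Polynomial.coeff q a" by simp
    then show "poly (P a) (real u) = poly (Q a) (real u)"
      using assms(3) by (simp add: p_def q_def coeff_sum coeff_monom)
  qed
qed

lemma eventually_polynomial_iff_rows:
  "(\<exists>p. eventually_polynomial (\<lambda>r u. enat (G r u)) d p \<and> (\<forall>a b. a + b \<le> d \<longrightarrow> p a b = Polynomial.coeff (P a) b))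
     \<and> (\<forall>a\<le>d. degree (P a) \<le> d - a)
   \<longleftrightarrow> bivariate_rows (\<lambda>r u. real (G r u)) d P"
proof -
  have eq: "(\<Sum>a\<le>d. \<Sum>b\<le>d - a. p a b * real r ^ a * real u ^ b) = (\<Sum>a\<le>d. poly (P a) (real u) * real r ^ a)"
    if "\<forall>a b. a + b \<le> d \<longrightarrow> p a b = Polynomial.coeff (P a) b" "\<forall>a\<le>d. degree (P a) \<le> d - a" for p r u
  proof (rule sum.cong[OF refl])
    fix a assume a: "a \<in> {..d}"
    have "poly (P a) (real u) = (\<Sum>b\<le>d - a. Polynomial.coeff (P a) b * real u ^ b)"
      using that(2) a poly_eq_sum_coeffs[of "P a" "d - a"] by simp
    also have "\<dots> = (\<Sum>b\<le>d - a. p a b * real u ^ b)" using that(1) a by (intro sum.cong refl) auto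
    finally show "(\<Sum>b\<le>d - a. p a b * real r ^ a * real u ^ b) = poly (P a) (real u) * real r ^ a"
      by (simp only: sum_distrib_right) (simp add: mult_ac)
  qed
  show ?thesis (is "?L \<longleftrightarrow> ?R")
  proof
    assume ?L
    then obtain p N where p: "\<forall>a b. a + b \<le> d \<longrightarrow> p a b = Polynomial.coeff (P a) b" "\<forall>a\<le>d. degree (P a) \<le> d - a"
      "\<forall>r\<ge>N. \<forall>u\<ge>N. real (G r u) = (\<Sum>a\<le>d. \<Sum>b\<le>d - a. p a b * real r ^ a * real u ^ b)"
      unfolding eventually_polynomial_def by auto
    then show ?R unfolding bivariate_rows_def eq[OF p(1,2)] by blast
  next
    assume R: ?R
    then have "eventually_polynomial (\<lambda>r u. enat (G r u)) d (\<lambda>a b. Polynomial.coeff (P a) b)"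
      unfolding eventually_polynomial_def bivariate_rows_def
      by (simp add: eq[of "\<lambda>a b. Polynomial.coeff (P a) b"])
    then show ?L using R unfolding bivariate_rows_def by blast
  qed
qed

lemma eventually_polynomial_leading_iff:
  "(\<exists>p. eventually_polynomial (\<lambda>r u. enat (G r u)) d p \<and> (\<forall>j\<le>d. p (d - j) j = f j))
   \<longleftrightarrow> (\<exists>P. bivariate_rows (\<lambda>r u. real (G r u)) d P \<and> (\<forall>j\<le>d. Polynomial.coeff (P (d - j)) j = f j))"
  (is "?L \<longleftrightarrow> ?R")
proof
  assume ?L
  then obtain p where p: "eventually_polynomial (\<lambda>r u. enat (G r u)) d p" "\<forall>j\<le>d. p (d - j) j = f j" by blast
  define P where "P a = (\<Sum>b\<le>d - a. Polynomial.monom (p a b) b)" for a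
  have coeff: "Polynomial.coeff (P a) b = (if b \<le> d - a then p a b else 0)" for a b
    by (simp add: P_def coeff_sum coeff_monom)
  have "degree (P a) \<le> d - a" for a by (rule degree_le) (auto simp: coeff)
  then have "bivariate_rows (\<lambda>r u. real (G r u)) d P"
    using p(1) by (subst eventually_polynomial_iff_rows[symmetric]) (auto simp: coeff intro!: exI[of _ p])
  then show ?R using p(2) by (intro exI[of _ P]) (simp add: coeff)
next
  assume ?R
  then obtain P where P: "bivariate_rows (\<lambda>r u. real (G r u)) d P" "\<forall>j\<le>d. Polynomial.coeff (P (d - j)) j = f j" by blast
  then obtain p where p: "eventually_polynomial (\<lambda>r u. enat (G r u)) d p"
    "\<forall>a b. a + b \<le> d \<longrightarrow> p a b = Polynomial.coeff (P a) b"
    using eventually_polynomial_iff_rows[of G d P] by blast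
  then show ?L using P(2) by (intro exI[of _ p]) auto
qed

lemma bivariate_rows_backward_diff:
  assumes h: "\<And>r u. h r u = (\<Sum>b\<le>u. H r b)" and P: "bivariate_rows h (Suc d) P"
  shows "bivariate_rows H d (\<lambda>a. backward_diff (P a))"
proof -
  obtain N where N: "\<And>r u. r \<ge> N \<Longrightarrow> u \<ge> N \<Longrightarrow> h r u = (\<Sum>a\<le>Suc d. poly (P a) (real u) * real r ^ a)"
    using P unfolding bivariate_rows_def by blast
  have deg: "degree (P a) \<le> Suc (d - a)" if "a \<le> d" for a
    using P that unfolding bivariate_rows_def by (metis Suc_diff_le le_SucI)
  have "degree (P (Suc d)) = 0" using P unfolding bivariate_rows_def by force
  then obtain c where c: "P (Suc d) = [:c:]" by (auto elim: degree_eq_zeroE)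
  have "H r u = (\<Sum>a\<le>d. poly (backward_diff (P a)) (real u) * real r ^ a)" if ru: "r \<ge> Suc N" "u \<ge> Suc N" for r u
  proof -
    obtain v where v: "u = Suc v" using ru(2) Suc_le_D by blast
    have "H r u = h r u - h r v" by (simp add: h v)
    also have "\<dots> = (\<Sum>a\<le>Suc d. poly (backward_diff (P a)) (real u) * real r ^ a)"
      using ru v N by (simp add: poly_backward_diff sum_subtractf algebra_simps)
    finally show ?thesis by (simp add: backward_diff_def c)
  qed
  then show ?thesis
    using backward_diff_leading[OF deg] unfolding bivariate_rows_def by (intro conjI allI impI exI[of _ "Suc N"]) auto
qed

text \<open>
  Choose \<open>S a\<close> with backward difference \<open>P a\<close>. For \<open>u\<close> beyond the threshold \<open>N\<close>, the differences of \<open>h r u\<close> in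
  \<open>u\<close> are those of the polynomial with coefficients \<open>S a\<close>, so \<open>h r u\<close> differs from that polynomial by
  a function of \<open>r\<close> alone, which is a polynomial because \<open>h r N\<close> is one. The coefficient of \<open>r\<^bsup>d + 1\<^esup>\<close> comes entirely
  from \<open>h r N\<close>; recording this is what makes it possible to prove that \<open>c\<^sub>0\<close> is an integer.
\<close>

lemma bivariate_rows_sum:
  assumes h: "\<And>r u. h r u = (\<Sum>b\<le>u. H r b)" and P: "bivariate_rows H d P"
    and columns: "\<And>u. \<exists>T N. degree T \<le> Suc d \<and> (\<forall>r\<ge>N. H r u = poly T (real r))"
  shows "\<exists>Q. bivariate_rows h (Suc d) Q \<and> (\<forall>a\<le>d. backward_diff (Q a) = P a) \<and>
    (\<exists>T N. degree T \<le> Suc d \<and> Q (Suc d) = [:Polynomial.coeff T (Suc d):] \<and>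
      (\<exists>u. \<forall>r\<ge>N. h r u = poly T (real r)))"
proof -
  obtain N where N: "\<And>r u. r \<ge> N \<Longrightarrow> u \<ge> N \<Longrightarrow> H r u = (\<Sum>a\<le>d. poly (P a) (real u) * real r ^ a)"
    using P unfolding bivariate_rows_def by blast
  obtain T K where T: "\<And>u. degree (T u) \<le> Suc d" "\<And>u r. r \<ge> K u \<Longrightarrow> H r u = poly (T u) (real r)"
    using columns by metis
  \<comment> \<open>The value at \<open>u = N\<close> is a sum of finitely many columns, hence a polynomial in \<open>r\<close> for large \<open>r\<close>.\<close>
  define T0 where "T0 = (\<Sum>b\<le>N. T b)"
  define K0 where "K0 = Max (insert N (K ` {..N}))"
  have T0: "degree T0 \<le> Suc d" unfolding T0_def by (intro degree_sum_le) (auto simp: T)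
  have KN: "K0 \<ge> N" unfolding K0_def by (intro Max_ge) auto
  have KK: "K0 \<ge> K b" if "b \<le> N" for b unfolding K0_def using that by (intro Max_ge) auto
  have hT: "h r N = poly T0 (real r)" if "r \<ge> K0" for r
    unfolding h T0_def poly_sum using that KK by (intro sum.cong refl T(2)) force
  have "\<forall>a. \<exists>s. a \<le> d \<longrightarrow> degree s \<le> Suc (d - a) \<and> backward_diff s = P a"
    using P backward_diff_surj unfolding bivariate_rows_def by blast
  then obtain S where S: "\<And>a. a \<le> d \<Longrightarrow> degree (S a) \<le> Suc (d - a) \<and> backward_diff (S a) = P a" by metis
  \<comment> \<open>Each \<open>S a\<close> is normalised to vanish at \<open>N\<close>, where \<open>T0\<close> supplies the value.\<close>
  define Q where "Q a = (if a \<le> d then S a - [:poly (S a) (real N):] else 0) + [:Polynomial.coeff T0 a:]" for a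
  have hsum: "h r u = h r N + (\<Sum>a\<le>d. (poly (S a) (real u) - poly (S a) (real N)) * real r ^ a)"
    if "r \<ge> N" "u \<ge> N" for r u
    using that(2)
  proof (induction u rule: dec_induct)
    case (step u)
    have "h r (Suc u) = h r u + H r (Suc u)" by (simp add: h)
    also have "H r (Suc u) = (\<Sum>a\<le>d. poly (P a) (real (Suc u)) * real r ^ a)"
      using N[of r "Suc u"] that(1) step.hyps by simp
    also have "\<dots> = (\<Sum>a\<le>d. (poly (S a) (real (Suc u)) - poly (S a) (real u)) * real r ^ a)"
    proof (rule sum.cong[OF refl])
      fix a assume "a \<in> {..d}"
      then have "poly (P a) (real (Suc u)) = poly (S a) (real (Suc u)) - poly (S a) (real u)"
        using S[of a] poly_backward_diff[of "S a" "real (Suc u)"] by simp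
      then show "poly (P a) (real (Suc u)) * real r ^ a
          = (poly (S a) (real (Suc u)) - poly (S a) (real u)) * real r ^ a" by simp
    qed
    finally show ?case unfolding step.IH by (simp add: sum.distrib[symmetric] algebra_simps)
  qed simp
  have "bivariate_rows h (Suc d) Q"
    unfolding bivariate_rows_def
  proof (intro conjI allI impI exI[of _ K0])
    fix a assume "a \<le> Suc d"
    then show "degree (Q a) \<le> Suc d - a"
      using S[of a] unfolding Q_def
      by (auto intro!: degree_add_le degree_diff_le simp: Suc_diff_le)
  next
    fix r u assume ru: "r \<ge> K0" "u \<ge> K0"
    have "h r N = (\<Sum>a\<le>Suc d. Polynomial.coeff T0 a * real r ^ a)"
      using hT ru(1) poly_eq_sum_coeffs[OF T0] by simp
    then show "h r u = (\<Sum>a\<le>Suc d. poly (Q a) (real u) * real r ^ a)"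
      using hsum[of r u] ru KN by (simp add: Q_def sum.distrib[symmetric] algebra_simps)
  qed
  moreover have "backward_diff (Q a) = P a" if "a \<le> d" for a
    using that S[of a] by (simp add: Q_def backward_diff_def pcompose_add pcompose_diff)
  moreover have "Q (Suc d) = [:Polynomial.coeff T0 (Suc d):]" by (simp add: Q_def)
  ultimately show ?thesis using T0 hT by blast
qed

section \<open>Comparison of the leading coefficients\<close>

text \<open>
  If neither predicate is satisfiable, both are the constant predicate \<open>False\<close>, so the two descriptions are
  literally the same term.
\<close>

lemma The_eq_by_correspondence:
  assumes "\<And>c c'. A c \<Longrightarrow> A c' \<Longrightarrow> c = c'" "\<And>c c'. B c \<Longrightarrow> B c' \<Longrightarrow> c = c'"
    and "\<And>c. A c \<Longrightarrow> \<exists>c'. B c' \<and> c' i = c i" and "\<And>c. B c \<Longrightarrow> \<exists>c'. A c'"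
  shows "(THE c. A c) i = (THE c. B c) i"
proof (cases "\<exists>c. A c")
  case True
  then obtain c c' where c: "A c" "B c'" "c' i = c i" using assms(3) by blast
  have "(THE c. A c) = c" "(THE c. B c) = c'" using c assms(1,2) by (auto intro: the_equality)
  then show ?thesis using c(3) by simp
next
  case False
  then have "A = (\<lambda>_. False)" "B = (\<lambda>_. False)" using assms(4) by blast+
  then show ?thesis by simp
qed

text \<open>
  Here \<open>h\<close> is the sum transform of \<open>H\<close> in \<open>u\<close>. Differences in \<open>u\<close> carry a solution of the defining condition for
  \<open>h\<close> to one for \<open>H\<close>, forgetting \<open>c 0\<close>; sums in \<open>u\<close> carry a solution for \<open>H\<close> to one for \<open>h\<close>, and the
  behaviour of \<open>H\<close> in \<open>r\<close> for fixed \<open>u\<close> provides the integer \<open>c 0\<close>. Uniqueness of the coefficients of a bivariate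
  polynomial makes both conditions uniquely solvable as soon as they are solvable.
\<close>

lemma leading_sequences_agree:
  fixes H :: "nat \<Rightarrow> nat \<Rightarrow> nat"
  assumes columns: "\<And>u. \<exists>T N. degree T \<le> Suc d \<and> (\<forall>r\<ge>N. real (H r u) = poly T (real r))"
    and h: "\<And>r u. h r u = (\<Sum>b\<le>u. H r b)"
    and i: "1 \<le> i" "i \<le> Suc d"
  shows "(THE c :: nat \<Rightarrow> int. (\<forall>i. i \<notin> {1..Suc d} \<longrightarrow> c i = 0) \<and>
        (\<exists>p. eventually_polynomial (\<lambda>r u. enat (H r u)) d p \<and>
          (\<forall>i\<in>{1..Suc d}. p (Suc d - i) (i - 1) = of_int (c i) / (fact (Suc d - i) * fact (i - 1))))) i
      = (THE c :: nat \<Rightarrow> int. (\<forall>i. i \<notin> {0..Suc d} \<longrightarrow> c i = 0) \<and>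
        (\<exists>p. eventually_polynomial (\<lambda>r u. enat (h r u)) (Suc d) p \<and>
          (\<forall>i\<in>{0..Suc d}. p (Suc d - i) i = of_int (c i) / (fact (Suc d - i) * fact i)))) i"
  (is "(THE c. ?A c) i = (THE c. ?B c) i")
proof -
  have A: "?A c \<longleftrightarrow> (\<forall>i. i \<notin> {1..Suc d} \<longrightarrow> c i = 0) \<and> (\<exists>P. bivariate_rows (\<lambda>r u. real (H r u)) d P \<and>
      (\<forall>j\<le>d. Polynomial.coeff (P (d - j)) j = of_int (c (Suc j)) / (fact (d - j) * fact j)))" for c
  proof -
    have "(\<forall>i\<in>{1..Suc d}. p (Suc d - i) (i - 1) = of_int (c i) / (fact (Suc d - i) * fact (i - 1))) \<longleftrightarrow>
      (\<forall>j\<le>d. p (d - j) j = of_int (c (Suc j)) / (fact (d - j) * fact j))" for p :: "nat \<Rightarrow> nat \<Rightarrow> real"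
      unfolding atLeastAtMost_iff Ball_def
      by (rule iffI) (metis One_nat_def Suc_le_mono diff_Suc_1 diff_Suc_Suc le_add1 plus_1_eq_Suc,
          metis One_nat_def Suc_le_mono Suc_pred' diff_Suc_Suc less_eq_Suc_le)
    then show ?thesis by (simp only: eventually_polynomial_leading_iff)
  qed
  have B: "?B c \<longleftrightarrow> (\<forall>i. i \<notin> {0..Suc d} \<longrightarrow> c i = 0) \<and> (\<exists>P. bivariate_rows (\<lambda>r u. real (h r u)) (Suc d) P \<and>
      (\<forall>j\<le>Suc d. Polynomial.coeff (P (Suc d - j)) j = of_int (c j) / (fact (Suc d - j) * fact j)))" for c
    unfolding eventually_polynomial_leading_iff[symmetric] by auto
  have h': "real (h r u) = (\<Sum>b\<le>u. real (H r b))" for r u by (simp add: h)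
  have A_unique: "c = c'" if cc: "?A c" "?A c'" for c c'
  proof
    fix i
    show "c i = c' i"
    proof (cases "i \<in> {1..Suc d}")
      case True
      then obtain j where j: "i = Suc j" "j \<le> d" by (cases i) auto
      obtain P P' where PP: "bivariate_rows (\<lambda>r u. real (H r u)) d P" "bivariate_rows (\<lambda>r u. real (H r u)) d P'"
        "Polynomial.coeff (P (d - j)) j = of_int (c i) / (fact (d - j) * fact j)"
        "Polynomial.coeff (P' (d - j)) j = of_int (c' i) / (fact (d - j) * fact j)"
        using cc[unfolded A] j by blast
      have "P (d - j) = P' (d - j)" using bivariate_rows_unique[OF PP(1,2)] by simp
      then show ?thesis using PP(3,4) by simp
    qed (use cc in simp)
  qed
  have B_unique: "c = c'" if cc: "?B c" "?B c'" for c c'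
  proof
    fix i
    show "c i = c' i"
    proof (cases "i \<in> {0..Suc d}")
      case True
      obtain P P' where PP: "bivariate_rows (\<lambda>r u. real (h r u)) (Suc d) P" "bivariate_rows (\<lambda>r u. real (h r u)) (Suc d) P'"
        "Polynomial.coeff (P (Suc d - i)) i = of_int (c i) / (fact (Suc d - i) * fact i)"
        "Polynomial.coeff (P' (Suc d - i)) i = of_int (c' i) / (fact (Suc d - i) * fact i)"
        using cc[unfolded B] True unfolding atLeastAtMost_iff by blast
      have "P (Suc d - i) = P' (Suc d - i)" using bivariate_rows_unique[OF PP(1,2)] by simp
      then show ?thesis using PP(3,4) by simp
    qed (use cc in simp)
  qed
  have leading: "Polynomial.coeff (backward_diff p) j = real (Suc j) * Polynomial.coeff p (Suc j)"
    if "bivariate_rows F (Suc d) P" "j \<le> d" "p = P (d - j)" for F P p j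
  proof (rule backward_diff_leading[THEN conjunct2])
    have "degree (P (d - j)) \<le> Suc d - (d - j)" using that(1) unfolding bivariate_rows_def by simp
    then show "degree p \<le> Suc j" using that(2,3) by simp
  qed
  have cancel: "real (Suc j) * (x / (fact k * fact (Suc j))) = x / (fact k * fact j)" for x j k
    by (simp del: of_nat_Suc)
  have B_imp_A: "?A (\<lambda>i. if i = 0 then 0 else c i)" if "?B c" for c
  proof -
    obtain P where P: "bivariate_rows (\<lambda>r u. real (h r u)) (Suc d) P"
      "\<And>j. j \<le> Suc d \<Longrightarrow> Polynomial.coeff (P (Suc d - j)) j = of_int (c j) / (fact (Suc d - j) * fact j)"
      using \<open>?B c\<close> unfolding B by blast
    have "Polynomial.coeff (backward_diff (P (d - j))) j = of_int (c (Suc j)) / (fact (d - j) * fact j)"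
      if "j \<le> d" for j
      using leading[OF P(1) that refl] P(2)[of "Suc j"] that cancel by (simp del: fact_Suc of_nat_Suc)
    then show ?thesis
      unfolding A using bivariate_rows_backward_diff[OF h' P(1)] \<open>?B c\<close> by auto
  qed
  have A_imp_B: "\<exists>c'. ?B c' \<and> c' i = c i" if "?A c" for c
  proof -
    obtain P where P: "bivariate_rows (\<lambda>r u. real (H r u)) d P"
      "\<And>j. j \<le> d \<Longrightarrow> Polynomial.coeff (P (d - j)) j = of_int (c (Suc j)) / (fact (d - j) * fact j)"
      using \<open>?A c\<close> unfolding A by blast
    obtain Q T N u where Q: "bivariate_rows (\<lambda>r u. real (h r u)) (Suc d) Q"
      "\<And>a. a \<le> d \<Longrightarrow> backward_diff (Q a) = P a" "degree T \<le> Suc d"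
      "Q (Suc d) = [:Polynomial.coeff T (Suc d):]" "\<And>r. r \<ge> N \<Longrightarrow> real (h r u) = poly T (real r)"
      using bivariate_rows_sum[OF h' P(1) columns] by blast
    have "fact (Suc d) * Polynomial.coeff T (Suc d) \<in> \<int>"
      by (rule integer_valued_poly_coeff[OF Q(3), of N]) (use Q(5) in \<open>metis Ints_of_nat\<close>)
    then obtain c0 where c0: "fact (Suc d) * Polynomial.coeff T (Suc d) = of_int c0" by (auto elim: Ints_cases)
    define c' where "c' = c(0 := c0)"
    have "Polynomial.coeff (Q (Suc d - j)) j = of_int (c' j) / (fact (Suc d - j) * fact j)" if "j \<le> Suc d" for j
    proof (cases j)
      case 0
      have "Polynomial.coeff T (Suc d) = of_int c0 / fact (Suc d)"
        unfolding c0[symmetric] by (simp del: fact_Suc)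
      then show ?thesis using 0 Q(4) by (simp add: c'_def del: fact_Suc)
    next
      case (Suc m)
      then have "m \<le> d" using that by simp
      then have "real (Suc m) * Polynomial.coeff (Q (d - m)) (Suc m) = of_int (c (Suc m)) / (fact (d - m) * fact m)"
        using leading[OF Q(1) _ refl, of m] P(2)[of m] Q(2)[of "d - m"] by simp
      also have "\<dots> = real (Suc m) * (of_int (c (Suc m)) / (fact (d - m) * fact (Suc m)))"
        by (rule cancel[symmetric])
      finally have "Polynomial.coeff (Q (d - m)) (Suc m) = of_int (c (Suc m)) / (fact (d - m) * fact (Suc m))"
        by (subst (asm) mult_left_cancel) simp_all
      then show ?thesis using Suc by (simp add: c'_def)
    qed
    moreover have "\<forall>i. i \<notin> {0..Suc d} \<longrightarrow> c' i = 0" using \<open>?A c\<close> by (simp add: c'_def)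
    ultimately have "?B c'" unfolding B using Q(1) by blast
    then show ?thesis using i by (intro exI[of _ c']) (simp add: c'_def)
  qed
  show ?thesis
  proof (rule The_eq_by_correspondence)
    show "\<And>c c'. ?A c \<Longrightarrow> ?A c' \<Longrightarrow> c = c'" by (rule A_unique)
    show "\<And>c c'. ?B c \<Longrightarrow> ?B c' \<Longrightarrow> c = c'" by (rule B_unique)
    show "\<And>c. ?A c \<Longrightarrow> \<exists>c'. ?B c' \<and> c' i = c i" by (rule A_imp_B)
    show "\<And>c. ?B c \<Longrightarrow> \<exists>c'. ?A c'" by (rule exI, rule B_imp_A)
  qed
qed

section \<open>Spans of subsets of a module\<close>

context module
begin

abbreviation span :: "'c set \<Rightarrow> 'c set" where
  "span S \<equiv> generated_submodule R M S"

lemma submodule_zero: "submodule H R M \<Longrightarrow> \<zero>\<^bsub>M\<^esub> \<in> H"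
  using subgroup.one_closed[OF submodule.axioms(1)] by fastforce

lemma submodule_add_cancel:
  assumes "submodule H R M" "x \<in> H" "y \<in> carrier M" "x \<oplus>\<^bsub>M\<^esub> y \<in> H" shows "y \<in> H"
proof -
  have x: "x \<in> carrier M" using submoduleE(1)[OF assms(1)] assms(2) by blast
  have "\<ominus>\<^bsub>M\<^esub> x \<oplus>\<^bsub>M\<^esub> (x \<oplus>\<^bsub>M\<^esub> y) \<in> H" using submoduleE(3,5)[OF assms(1)] assms(2,4) by blast
  then show ?thesis using x assms(3) by (simp add: M.r_neg2 M.r_neg1)
qed

lemma submodule_Int:
  assumes A: "submodule A R M" and B: "submodule B R M" shows "submodule (A \<inter> B) R M"
  by (rule submoduleI) (use submoduleE[OF A] submoduleE[OF B] submodule_zero[OF A] submodule_zero[OF B] in auto)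

lemma span_superset: "S \<subseteq> span S"
  unfolding generated_submodule_def by blast

lemma span_least: "submodule H R M \<Longrightarrow> S \<subseteq> H \<Longrightarrow> span S \<subseteq> H"
  unfolding generated_submodule_def by blast

lemma span_submodule:
  assumes "S \<subseteq> carrier M" shows "submodule (span S) R M"
proof (rule submoduleI)
  show "span S \<subseteq> carrier M" by (rule span_least[OF carrier_is_submodule assms])
qed (auto simp: generated_submodule_def submodule_zero submoduleE)

lemma span_carrier: "S \<subseteq> carrier M \<Longrightarrow> span S \<subseteq> carrier M"
  by (rule span_least[OF carrier_is_submodule])

lemma span_eq_self: "submodule H R M \<Longrightarrow> span H = H"
  using span_least span_superset by blast

lemma span_mono: "S \<subseteq> T \<Longrightarrow> span S \<subseteq> span T"
  unfolding generated_submodule_def by blast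

lemma span_subset_span: "T \<subseteq> carrier M \<Longrightarrow> S \<subseteq> span T \<Longrightarrow> span S \<subseteq> span T"
  by (rule span_least[OF span_submodule])

lemma span_Un_span: "S \<union> T \<subseteq> carrier M \<Longrightarrow> span (span S \<union> T) = span (S \<union> T)"
proof
  assume ST: "S \<union> T \<subseteq> carrier M"
  have "span S \<subseteq> span (S \<union> T)" by (rule span_mono) simp
  then show "span (span S \<union> T) \<subseteq> span (S \<union> T)"
    using span_superset[of "S \<union> T"] by (intro span_subset_span[OF ST]) blast
  show "span (S \<union> T) \<subseteq> span (span S \<union> T)" using span_superset[of S] by (intro span_mono) blast
qed

lemma submodule_vimage_smult:
  assumes "submodule H R M" "a \<in> carrier R"
  shows "submodule {y \<in> carrier M. a \<odot>\<^bsub>M\<^esub> y \<in> H} R M"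
proof (rule submoduleI)
  fix b x assume *: "b \<in> carrier R" "x \<in> {y \<in> carrier M. a \<odot>\<^bsub>M\<^esub> y \<in> H}"
  have "a \<odot>\<^bsub>M\<^esub> (b \<odot>\<^bsub>M\<^esub> x) = b \<odot>\<^bsub>M\<^esub> (a \<odot>\<^bsub>M\<^esub> x)"
    using * assms(2) by (simp add: smult_assoc1[symmetric] R.m_comm)
  then show "b \<odot>\<^bsub>M\<^esub> x \<in> {y \<in> carrier M. a \<odot>\<^bsub>M\<^esub> y \<in> H}"
    using * submoduleE(4)[OF assms(1)] by simp
qed (use assms submoduleE[OF assms(1)] submodule_zero[OF assms(1)] in
      \<open>auto simp: smult_r_distr smult_r_minus\<close>)

lemma ideal_transporter:
  assumes C: "submodule C R M" and v: "v \<in> carrier M"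
  shows "ideal {r \<in> carrier R. r \<odot>\<^bsub>M\<^esub> v \<in> C} R"
proof (rule idealI)
  show "subgroup {r \<in> carrier R. r \<odot>\<^bsub>M\<^esub> v \<in> C} (add_monoid R)"
    using submoduleE[OF C] submodule_zero[OF C] v
    by unfold_locales (auto simp: smult_l_distr smult_l_minus a_inv_def[symmetric])
  fix a x assume a: "a \<in> {r \<in> carrier R. r \<odot>\<^bsub>M\<^esub> v \<in> C}" and x: "x \<in> carrier R"
  then show "x \<otimes> a \<in> {r \<in> carrier R. r \<odot>\<^bsub>M\<^esub> v \<in> C}"
    using v submoduleE(4)[OF C] by (simp add: smult_assoc1)
  then show "a \<otimes> x \<in> {r \<in> carrier R. r \<odot>\<^bsub>M\<^esub> v \<in> C}" using a x by (simp add: R.m_comm)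
qed (rule R.ring_axioms)

lemma set_add_iff: "x \<in> A <+>\<^bsub>M\<^esub> B \<longleftrightarrow> (\<exists>a\<in>A. \<exists>b\<in>B. x = a \<oplus>\<^bsub>M\<^esub> b)"
  by (auto simp: set_add_def')

lemma submodule_set_add:
  assumes "submodule A R M" "submodule B R M"
  shows "submodule (A <+>\<^bsub>M\<^esub> B) R M"
proof (rule submoduleI)
  note A = submoduleE[OF assms(1)] and B = submoduleE[OF assms(2)]
  show "A <+>\<^bsub>M\<^esub> B \<subseteq> carrier M" using A(1) B(1) M.a_closed by (fastforce simp: set_add_iff)
  show "\<zero>\<^bsub>M\<^esub> \<in> A <+>\<^bsub>M\<^esub> B"
    unfolding set_add_iff using submodule_zero[OF assms(1)] submodule_zero[OF assms(2)] M.l_zero M.zero_closed by metis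
  fix x assume "x \<in> A <+>\<^bsub>M\<^esub> B"
  then obtain a b where x: "a \<in> A" "b \<in> B" "x = a \<oplus>\<^bsub>M\<^esub> b" by (auto simp: set_add_iff)
  have ab: "a \<in> carrier M" "b \<in> carrier M" using x A(1) B(1) by auto
  have "\<ominus>\<^bsub>M\<^esub> x = \<ominus>\<^bsub>M\<^esub> a \<oplus>\<^bsub>M\<^esub> \<ominus>\<^bsub>M\<^esub> b" using ab x by (simp add: M.minus_add)
  then show "\<ominus>\<^bsub>M\<^esub> x \<in> A <+>\<^bsub>M\<^esub> B" unfolding set_add_iff using x A(3) B(3) by blast
  { fix y assume "y \<in> A <+>\<^bsub>M\<^esub> B"
    then obtain c d where y: "c \<in> A" "d \<in> B" "y = c \<oplus>\<^bsub>M\<^esub> d" by (auto simp: set_add_iff)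
    have cd: "c \<in> carrier M" "d \<in> carrier M" using y A(1) B(1) by auto
    have "x \<oplus>\<^bsub>M\<^esub> y = (a \<oplus>\<^bsub>M\<^esub> c) \<oplus>\<^bsub>M\<^esub> (b \<oplus>\<^bsub>M\<^esub> d)"
      using x y ab cd by (simp add: M.a_ac)
    then show "x \<oplus>\<^bsub>M\<^esub> y \<in> A <+>\<^bsub>M\<^esub> B" unfolding set_add_iff using x y A(5) B(5) by blast }
  { fix r assume r: "r \<in> carrier R"
    then have "r \<odot>\<^bsub>M\<^esub> x = r \<odot>\<^bsub>M\<^esub> a \<oplus>\<^bsub>M\<^esub> r \<odot>\<^bsub>M\<^esub> b" using ab x by (simp add: smult_r_distr)
    then show "r \<odot>\<^bsub>M\<^esub> x \<in> A <+>\<^bsub>M\<^esub> B" unfolding set_add_iff using x A(4) B(4) r by blast }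
qed

lemma span_Un_submodules:
  assumes "submodule A R M" "submodule B R M"
  shows "span (A \<union> B) = A <+>\<^bsub>M\<^esub> B"
proof
  note A = submoduleE(1)[OF assms(1)] and B = submoduleE(1)[OF assms(2)]
  have "a \<in> A <+>\<^bsub>M\<^esub> B" if "a \<in> A" for a
    unfolding set_add_iff using that submodule_zero[OF assms(2)] A by (intro bexI[of _ a] bexI[of _ "\<zero>\<^bsub>M\<^esub>"]) auto
  moreover have "b \<in> A <+>\<^bsub>M\<^esub> B" if "b \<in> B" for b
    unfolding set_add_iff using that submodule_zero[OF assms(1)] B by (intro bexI[of _ b] bexI[of _ "\<zero>\<^bsub>M\<^esub>"]) auto
  ultimately show "span (A \<union> B) \<subseteq> A <+>\<^bsub>M\<^esub> B"
    by (intro span_least[OF submodule_set_add[OF assms]]) blast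
  have "submodule (span (A \<union> B)) R M" using A B by (intro span_submodule) blast
  then show "A <+>\<^bsub>M\<^esub> B \<subseteq> span (A \<union> B)"
    using span_superset[of "A \<union> B"] submoduleE(5) by (fastforce simp: set_add_iff)
qed

lemma submodule_singleton_multiples:
  assumes "v \<in> carrier M" shows "submodule {a \<odot>\<^bsub>M\<^esub> v | a. a \<in> carrier R} R M"
proof (rule submoduleI)
  show "\<zero>\<^bsub>M\<^esub> \<in> {a \<odot>\<^bsub>M\<^esub> v | a. a \<in> carrier R}" using smult_l_null[OF assms] R.zero_closed by force
  fix x assume "x \<in> {a \<odot>\<^bsub>M\<^esub> v | a. a \<in> carrier R}"
  then obtain a where a: "a \<in> carrier R" "x = a \<odot>\<^bsub>M\<^esub> v" by blast
  then show "\<ominus>\<^bsub>M\<^esub> x \<in> {a \<odot>\<^bsub>M\<^esub> v | a. a \<in> carrier R}"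
    using assms smult_l_minus[of a v] by (intro CollectI exI[of _ "\<ominus> a"]) auto
  { fix y assume "y \<in> {a \<odot>\<^bsub>M\<^esub> v | a. a \<in> carrier R}"
    then obtain b where "b \<in> carrier R" "y = b \<odot>\<^bsub>M\<^esub> v" by blast
    then show "x \<oplus>\<^bsub>M\<^esub> y \<in> {a \<odot>\<^bsub>M\<^esub> v | a. a \<in> carrier R}"
      using assms a by (intro CollectI exI[of _ "a \<oplus> b"]) (auto simp: smult_l_distr) }
  { fix b assume "b \<in> carrier R"
    then show "b \<odot>\<^bsub>M\<^esub> x \<in> {a \<odot>\<^bsub>M\<^esub> v | a. a \<in> carrier R}"
      using assms a by (intro CollectI exI[of _ "b \<otimes> a"]) (auto simp: smult_assoc1) }
qed (use assms in auto)

lemma span_insert_submodule: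
  assumes "submodule B R M" "v \<in> carrier M"
  shows "span (insert v B) = {a \<odot>\<^bsub>M\<^esub> v \<oplus>\<^bsub>M\<^esub> b | a b. a \<in> carrier R \<and> b \<in> B}" (is "_ = ?R")
proof
  note B = submoduleE[OF assms(1)]
  have R: "?R = {a \<odot>\<^bsub>M\<^esub> v | a. a \<in> carrier R} <+>\<^bsub>M\<^esub> B" by (auto simp: set_add_iff) blast+
  have "submodule ?R R M"
    unfolding R by (rule submodule_set_add[OF submodule_singleton_multiples[OF assms(2)] assms(1)])
  moreover have "v \<in> ?R"
    using assms(2) submodule_zero[OF assms(1)] by (intro CollectI exI[of _ \<one>] exI[of _ "\<zero>\<^bsub>M\<^esub>"]) auto
  moreover have "b \<in> ?R" if "b \<in> B" for b
    using assms(2) that B(1) by (intro CollectI exI[of _ \<zero>] exI[of _ b]) auto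
  ultimately show "span (insert v B) \<subseteq> ?R" by (intro span_least) blast+
  have "submodule (span (insert v B)) R M" using assms(2) B(1) by (intro span_submodule) blast
  note S = submoduleE(4,5)[OF this]
  show "?R \<subseteq> span (insert v B)"
  proof clarify
    fix a b assume ab: "a \<in> carrier R" "b \<in> B"
    have "v \<in> span (insert v B)" "b \<in> span (insert v B)" using ab(2) span_superset[of "insert v B"] by auto
    then show "a \<odot>\<^bsub>M\<^esub> v \<oplus>\<^bsub>M\<^esub> b \<in> span (insert v B)" by (intro S ab(1))
  qed
qed

section \<open>Lengths of subquotients\<close>

text \<open>
  Strict chains of length \<open>n\<close> of submodules descending from \<open>A\<close>, peeled off from the top. The lowest member
  only has to contain \<open>B\<close>, which makes the lengths that occur a downward closed set.
\<close>

primrec sub_chain :: "nat \<Rightarrow> 'c set \<Rightarrow> 'c set \<Rightarrow> bool" where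
  "sub_chain 0 A B \<longleftrightarrow> submodule A R M \<and> submodule B R M \<and> B \<subseteq> A"
| "sub_chain (Suc n) A B \<longleftrightarrow> submodule A R M \<and> (\<exists>C. C \<subset> A \<and> sub_chain n C B)"

definition sub_length :: "'c set \<Rightarrow> 'c set \<Rightarrow> enat" where
  "sub_length A B = (SUP n \<in> {n. sub_chain n A B}. enat n)"

lemma sub_chain_bounds:
  "sub_chain n A B \<Longrightarrow> submodule A R M \<and> submodule B R M \<and> B \<subseteq> A"
  by (induction n arbitrary: A) auto

lemma sub_chain_raise:
  assumes "sub_chain n C B" "C \<subseteq> A" "submodule A R M" shows "sub_chain n A B"
proof (cases n)
  case (Suc m)
  then obtain C' where "C' \<subset> C" "sub_chain m C' B" using assms(1) by auto
  then show ?thesis using assms(2,3) Suc by (metis psubset_subset_trans sub_chain.simps(2))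
qed (use assms order_trans[of B C A] in simp)

lemma sub_chain_Suc_D: "sub_chain (Suc n) A B \<Longrightarrow> sub_chain n A B"
  using sub_chain_raise by auto

lemma sub_chain_le:
  assumes "sub_chain n A B" "m \<le> n" shows "sub_chain m A B"
  using assms(2,1) by (induction rule: inc_induct) (blast dest: sub_chain_Suc_D)+

text \<open>
  Turns statements about lengths, infinite ones included, into statements about chains.
\<close>

lemma le_sub_length_iff:
  assumes "sub_chain 0 A B"
  shows "enat n \<le> sub_length A B \<longleftrightarrow> sub_chain n A B"
proof
  assume le: "enat n \<le> sub_length A B"
  show "sub_chain n A B"
  proof (rule ccontr)
    assume neg: "\<not> sub_chain n A B"
    have less: "m < n" if "sub_chain m A B" for m
      using neg sub_chain_le[OF that] by (meson not_less)
    then have "n > 0" using assms by blast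
    have "sub_length A B \<le> enat (n - 1)"
      unfolding sub_length_def
    proof (rule SUP_least)
      fix m assume "m \<in> {n. sub_chain n A B}"
      then have "m < n" using less by blast
      then show "enat m \<le> enat (n - 1)" by simp
    qed
    then show False using le \<open>n > 0\<close> by (metis diff_less enat_ord_simps(1) le_trans not_le zero_less_one order_trans)
  qed
qed (auto simp: sub_length_def intro: SUP_upper)

lemma enat_le_by_numbers:
  assumes "\<And>n. enat n \<le> x \<Longrightarrow> enat n \<le> y" shows "x \<le> y"
proof (cases x)
  case infinity
  then have "y = \<infinity>" using assms by (metis enat_ord_code(3) enat_ord_simps(1) not_enat_eq not_less_eq_eq order_refl)
  then show ?thesis by simp
qed (use assms in simp)

lemma enat_le_add_iff:
  "enat n \<le> x + y \<longleftrightarrow> (\<exists>i j. i + j = n \<and> enat i \<le> x \<and> enat j \<le> y)"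
proof
  assume n: "enat n \<le> x + y"
  show "\<exists>i j. i + j = n \<and> enat i \<le> x \<and> enat j \<le> y"
  proof (cases x)
    case (enat k)
    show ?thesis
    proof (cases y)
      case (enat l)
      then show ?thesis using n \<open>x = enat k\<close> by (intro exI[of _ "min n k"] exI[of _ "n - min n k"]) auto
    qed (intro exI[of _ 0] exI[of _ n], simp add: zero_enat_def[symmetric])
  qed (intro exI[of _ n] exI[of _ 0], simp add: zero_enat_def[symmetric])
next
  assume "\<exists>i j. i + j = n \<and> enat i \<le> x \<and> enat j \<le> y"
  then show "enat n \<le> x + y" by (metis add_mono plus_enat_simps(1))
qed

lemma sub_chain_append:
  "sub_chain i A K \<Longrightarrow> sub_chain j K B \<Longrightarrow> sub_chain (i + j) A B"
proof (induction i arbitrary: A)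
  case 0
  then show ?case using sub_chain_raise by auto
qed auto

text \<open>
  Intersecting a chain with \<open>K\<close> and adding \<open>K\<close> to it gives two chains; by the modular law every strict step
  stays strict in at least one of them.
\<close>

lemma sub_chain_split:
  assumes "sub_chain n A B" "submodule K R M" "B \<subseteq> K"
  shows "\<exists>i j. i + j = n \<and> sub_chain i (A <+>\<^bsub>M\<^esub> K) K \<and> sub_chain j (A \<inter> K) B"
  using assms(1)
proof (induction n arbitrary: A)
  case 0
  then have "submodule (A <+>\<^bsub>M\<^esub> K) R M" using assms submodule_set_add by simp
  moreover have "K \<subseteq> A <+>\<^bsub>M\<^esub> K"
    using span_Un_submodules[of A K] 0 assms span_superset[of "A \<union> K"] by auto
  moreover have "submodule (A \<inter> K) R M" using 0 assms submodule_Int by simp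
  ultimately show ?case using 0 assms by auto
next
  case (Suc n)
  then obtain C where C: "submodule A R M" "C \<subset> A" "sub_chain n C B" by auto
  then have Csub: "submodule C R M" using sub_chain_bounds by blast
  from Suc.IH[OF C(3)] obtain i j where ij: "i + j = n" "sub_chain i (C <+>\<^bsub>M\<^esub> K) K" "sub_chain j (C \<inter> K) B"
    by blast
  have sum: "submodule (A <+>\<^bsub>M\<^esub> K) R M" using C(1) assms(2) by (rule submodule_set_add)
  have int: "submodule (A \<inter> K) R M" using C(1) assms(2) by (rule submodule_Int)
  have le: "C <+>\<^bsub>M\<^esub> K \<subseteq> A <+>\<^bsub>M\<^esub> K" "C \<inter> K \<subseteq> A \<inter> K"
    using C(2) unfolding set_add_def' by blast+
  show ?case
  proof (cases "C \<inter> K = A \<inter> K")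
    case True
    \<comment> \<open>Modular law: if \<open>C\<close> and \<open>A\<close> also had the same sum with \<open>K\<close>, they would be equal.\<close>
    have "C <+>\<^bsub>M\<^esub> K \<noteq> A <+>\<^bsub>M\<^esub> K"
    proof
      assume eq: "C <+>\<^bsub>M\<^esub> K = A <+>\<^bsub>M\<^esub> K"
      have "A \<subseteq> C"
      proof
        fix a assume a: "a \<in> A"
        have "a \<in> A <+>\<^bsub>M\<^esub> K"
          using span_Un_submodules[OF C(1) assms(2)] span_superset[of "A \<union> K"] a by blast
        then obtain c k where ck: "c \<in> C" "k \<in> K" "a = c \<oplus>\<^bsub>M\<^esub> k"
          unfolding eq[symmetric] set_add_iff by blast
        have "k \<in> A" using submodule_add_cancel[OF C(1), of c k] ck a C(2) submoduleE(1)[OF assms(2)] by blast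
        then have "k \<in> C" using True ck(2) by blast
        then show "a \<in> C" using ck submoduleE(5)[OF Csub] by blast
      qed
      then show False using C(2) by blast
    qed
    then have "sub_chain (Suc i) (A <+>\<^bsub>M\<^esub> K) K" using ij(2) le(1) sum by auto
    moreover have "sub_chain j (A \<inter> K) B" using ij(3) True by simp
    ultimately show ?thesis using ij(1) by (intro exI[of _ "Suc i"] exI[of _ j]) simp
  next
    case False
    then have "sub_chain (Suc j) (A \<inter> K) B" using ij(3) le(2) int by auto
    moreover have "sub_chain i (A <+>\<^bsub>M\<^esub> K) K" using ij(2) le(1) sum sub_chain_raise by blast
    ultimately show ?thesis using ij(1) by (intro exI[of _ i] exI[of _ "Suc j"]) simp
  qed
qed

theorem sub_length_add:
  assumes "submodule A R M" "submodule K R M" "submodule B R M" "B \<subseteq> K" "K \<subseteq> A"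
  shows "sub_length A B = sub_length A K + sub_length K B"
proof -
  have AK: "A <+>\<^bsub>M\<^esub> K = A" using span_Un_submodules[of A K] span_eq_self[of A] assms by (simp add: Un_absorb2)
  have "sub_chain n A B \<longleftrightarrow> (\<exists>i j. i + j = n \<and> sub_chain i A K \<and> sub_chain j K B)" for n
    using sub_chain_split[of n A B K] sub_chain_append assms AK by (metis inf.absorb_iff2)
  then have "enat n \<le> sub_length A B \<longleftrightarrow> enat n \<le> sub_length A K + sub_length K B" for n
    using assms by (simp add: enat_le_add_iff le_sub_length_iff)
  then show ?thesis by (meson antisym enat_le_by_numbers)
qed

lemma sub_length_self: "submodule A R M \<Longrightarrow> sub_length A A = 0"
proof -
  assume A: "submodule A R M"
  have "sub_chain n A A \<longleftrightarrow> n = 0" for n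
    using A by (cases n) (auto dest: sub_chain_bounds)
  then show ?thesis by (simp add: sub_length_def zero_enat_def)
qed

text \<open>
  Multiplication by \<open>x\<close> maps a submodule of \<open>A/B\<close> onto \<open>A'/B'\<close>, and preimages of a strict chain form a
  strict chain.
\<close>

lemma sub_length_smult_le:
  assumes "submodule A R M" "submodule B R M" "B \<subseteq> A"
    and "submodule A' R M" "submodule B' R M" "B' \<subseteq> A'" and x: "x \<in> carrier R"
    and onto: "\<And>c. c \<in> A' \<Longrightarrow> \<exists>y\<in>A. \<exists>b\<in>B'. c = x \<odot>\<^bsub>M\<^esub> y \<oplus>\<^bsub>M\<^esub> b"
    and kernel: "\<And>y. y \<in> B \<Longrightarrow> x \<odot>\<^bsub>M\<^esub> y \<in> B'"
  shows "sub_length A' B' \<le> sub_length A B"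
proof -
  define pre where "pre C = A \<inter> {y \<in> carrier M. x \<odot>\<^bsub>M\<^esub> y \<in> C}" for C
  have pre: "submodule (pre C) R M" if "submodule C R M" for C
  proof -
    show ?thesis unfolding pre_def by (intro submodule_Int assms(1) submodule_vimage_smult that x)
  qed
  have "sub_chain n (pre C) B" if "sub_chain n C B'" "C \<subseteq> A'" for n C
    using that
  proof (induction n arbitrary: C)
    case 0
    then show ?case using assms(2,3) pre kernel submoduleE(1)[OF assms(2)] by (auto simp: pre_def)
  next
    case (Suc n)
    then obtain C' where C': "submodule C R M" "C' \<subset> C" "sub_chain n C' B'" by auto
    have sub': "submodule C' R M" "B' \<subseteq> C'" using sub_chain_bounds[OF C'(3)] by auto
    obtain c where c: "c \<in> C" "c \<notin> C'" using C'(2) by blast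
    then obtain y b where yb: "y \<in> A" "b \<in> B'" "c = x \<odot>\<^bsub>M\<^esub> y \<oplus>\<^bsub>M\<^esub> b" using onto Suc.prems(2) by blast
    have carr: "y \<in> carrier M" "b \<in> carrier M" "x \<odot>\<^bsub>M\<^esub> y \<in> carrier M"
      using yb submoduleE(1)[OF assms(1)] submoduleE(1)[OF assms(5)] x by auto
    have "b \<in> C" using yb(2) sub'(2) C'(2) by blast
    then have "x \<odot>\<^bsub>M\<^esub> y \<in> C"
      using submodule_add_cancel[OF C'(1), of b "x \<odot>\<^bsub>M\<^esub> y"] c(1) yb(3) carr by (simp add: M.a_comm)
    moreover have "x \<odot>\<^bsub>M\<^esub> y \<notin> C'"
      using c(2) yb(2,3) sub' submoduleE(5)[OF sub'(1)] by blast
    ultimately have "y \<in> pre C" "y \<notin> pre C'" using yb(1) carr by (simp_all add: pre_def)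
    moreover have "pre C' \<subseteq> pre C" using C'(2) unfolding pre_def by blast
    ultimately have "pre C' \<subset> pre C" by blast
    moreover have "sub_chain n (pre C') B" using Suc.IH[OF C'(3)] C'(2) Suc.prems(2) by blast
    ultimately show ?case using pre[OF C'(1)] by (metis sub_chain.simps(2))
  qed
  then have "sub_chain n A B" if "sub_chain n A' B'" for n
    using that sub_chain_raise[of n "pre A'" B A] assms(1) by (auto simp: pre_def)
  moreover have "sub_chain 0 A' B'" "sub_chain 0 A B" using assms(1-6) by simp_all
  ultimately show ?thesis by - (rule enat_le_by_numbers, simp add: le_sub_length_iff)
qed

text \<open>
  The quotient is a cyclic module over the residue field, hence zero or simple: for a proper submodule \<open>C\<close>
  between, the ideal of all \<open>r\<close> with \<open>r v \<in> C\<close> contains \<open>\<mm>\<close>.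
\<close>

lemma sub_length_insert_maximal:
  assumes max: "maximalideal \<mm> R" and B: "submodule B R M" and v: "v \<in> carrier M"
    and kill: "\<And>a. a \<in> \<mm> \<Longrightarrow> a \<odot>\<^bsub>M\<^esub> v \<in> B"
  shows "sub_length (span (insert v B)) B = (if v \<in> B then 0 else 1)"
proof (cases "v \<in> B")
  case True
  then show ?thesis using sub_length_self[OF B] span_eq_self[OF B] by (simp add: insert_absorb)
next
  case False
  interpret maximalideal \<mm> R by (rule max)
  let ?A = "span (insert v B)"
  have A: "submodule ?A R M" using v submoduleE(1)[OF B] by (intro span_submodule) blast
  have BA: "B \<subseteq> ?A" "v \<in> ?A" using span_superset[of "insert v B"] by auto
  have top: "C = ?A" if C: "submodule C R M" "B \<subset> C" "C \<subseteq> ?A" for C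
  proof -
    obtain c where c: "c \<in> C" "c \<notin> B" using C(2) by blast
    then obtain a b where ab: "a \<in> carrier R" "b \<in> B" "c = a \<odot>\<^bsub>M\<^esub> v \<oplus>\<^bsub>M\<^esub> b"
      using C(3) span_insert_submodule[OF B v] by blast
    have bc: "b \<in> carrier M" using ab(2) submoduleE(1)[OF B] by blast
    have "a \<notin> \<mm>" using kill ab c(2) submoduleE(5)[OF B] by blast
    have av: "a \<odot>\<^bsub>M\<^esub> v \<in> C"
      using submodule_add_cancel[OF C(1), of b "a \<odot>\<^bsub>M\<^esub> v"] ab c(1) C(2) v bc by (auto simp: M.a_comm)
    \<comment> \<open>The scalars that move \<open>v\<close> into \<open>C\<close> form an ideal strictly above \<open>\<mm>\<close>.\<close>
    define J where "J = {r \<in> carrier R. r \<odot>\<^bsub>M\<^esub> v \<in> C}"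
    have "ideal J R" unfolding J_def by (rule ideal_transporter[OF C(1) v])
    moreover have "\<mm> \<subseteq> J" using kill C(2) Icarr by (auto simp: J_def)
    moreover have "J \<noteq> \<mm>" using \<open>a \<notin> \<mm>\<close> av ab(1) by (auto simp: J_def)
    ultimately have "J = carrier R" using I_maximal[of J] by (auto simp: J_def)
    then have "\<one> \<in> J" using R.one_closed by blast
    then have "v \<in> C" using smult_one[OF v] by (simp add: J_def)
    then show "C = ?A" using C span_least[OF C(1), of "insert v B"] by blast
  qed
  have zero: "sub_chain 0 ?A B" using A B BA(1) by simp
  have "B \<subset> ?A" using BA False by blast
  then have one: "sub_chain (Suc 0) ?A B" unfolding sub_chain.simps using A B by blast
  have two: "\<not> sub_chain (Suc (Suc 0)) ?A B"
  proof
    assume "sub_chain (Suc (Suc 0)) ?A B"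
    then obtain C where "C \<subset> ?A" "submodule C R M" "B \<subset> C" unfolding sub_chain.simps by blast
    then show False using top[of C] by blast
  qed
  have "enat 1 \<le> sub_length ?A B" "\<not> enat 2 \<le> sub_length ?A B"
    using one two by (simp_all add: le_sub_length_iff[OF zero] numeral_2_eq_2 del: sub_chain.simps)
  then have "sub_length ?A B = 1" by (cases "sub_length ?A B") (auto simp: one_enat_def)
  then show ?thesis using False by simp
qed

end

section \<open>Noetherian induction on ideals\<close>

lemma (in noetherian_ring) noetherian_induct:
  assumes "ideal J R"
    and step: "\<And>J. ideal J R \<Longrightarrow> (\<And>K. ideal K R \<Longrightarrow> J \<subset> K \<Longrightarrow> Q K) \<Longrightarrow> Q J"
  shows "Q J"
proof (rule ccontr)
  assume neg: "\<not> Q J"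
  define A where "A = {K. ideal K R \<and> \<not> Q K}"
  have "\<exists>K\<in>A. \<forall>X\<in>A. K \<subseteq> X \<longrightarrow> X = K"
  proof (rule subset_Zorn_nonempty)
    show "A \<noteq> {}" using assms(1) neg by (auto simp: A_def)
    fix C assume C: "C \<noteq> {}" "subset.chain A C"
    then have "C \<subseteq> A" "subset.chain {I. ideal I R} C" unfolding pred_on.chain_def A_def by blast+
    then show "\<Union>C \<in> A" using ideal_chain_is_trivial[OF C(1)] by blast
  qed
  then obtain K where K: "K \<in> A" "\<And>X. X \<in> A \<Longrightarrow> K \<subseteq> X \<Longrightarrow> X = K" by blast
  have "Q L" if "ideal L R" "K \<subset> L" for L
  proof (rule ccontr)
    assume "\<not> Q L"
    then have "L = K" using that by (intro K(2)) (auto simp: A_def)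
    then show False using that(2) by blast
  qed
  moreover have "ideal K R" using K(1) by (simp add: A_def)
  ultimately have "Q K" using step by blast
  then show False using K(1) by (simp add: A_def)
qed

lemma (in noetherian_ring) proper_ideal_below_maximal:
  assumes "ideal J R" "J \<noteq> carrier R"
  shows "\<exists>P. maximalideal P R \<and> J \<subseteq> P"
proof -
  have "J \<noteq> carrier R \<longrightarrow> (\<exists>P. maximalideal P R \<and> J \<subseteq> P)"
  proof (rule noetherian_induct[OF assms(1)], rule impI)
    fix J assume J: "ideal J R" "J \<noteq> carrier R"
      and IH: "\<And>K. ideal K R \<Longrightarrow> J \<subset> K \<Longrightarrow> K \<noteq> carrier R \<longrightarrow> (\<exists>P. maximalideal P R \<and> K \<subseteq> P)"
    show "\<exists>P. maximalideal P R \<and> J \<subseteq> P"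
    proof (cases "maximalideal J R")
      case False
      then obtain K where "ideal K R" "J \<subset> K" "K \<noteq> carrier R"
        using maximalidealI[OF J(1)] J(2) by (metis psubsetI)
      then show ?thesis using IH by blast
    qed blast
  qed
  then show ?thesis using assms(2) by blast
qed

context module
begin

section \<open>Growth along a filtration\<close>

lemma ideal_colon:
  assumes J: "ideal J R" and a: "a \<in> carrier R"
  shows "ideal {r \<in> carrier R. r \<otimes> a \<in> J} R"
proof (rule idealI)
  note J' = ideal.axioms(1)[OF J]
  show "subgroup {r \<in> carrier R. r \<otimes> a \<in> J} (add_monoid R)"
    using additive_subgroup.zero_closed[OF J'] additive_subgroup.a_closed[OF J'] additive_subgroup.a_inv_closed[OF J'] a
    by unfold_locales (auto simp: R.l_distr R.l_minus a_inv_def[symmetric])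
  fix r x assume *: "r \<in> {r \<in> carrier R. r \<otimes> a \<in> J}" "x \<in> carrier R"
  have "(x \<otimes> r) \<otimes> a = x \<otimes> (r \<otimes> a)" using * a by (simp add: R.m_assoc)
  then show "x \<otimes> r \<in> {r \<in> carrier R. r \<otimes> a \<in> J}" using * ideal.I_l_closed[OF J] by simp
  then show "r \<otimes> x \<in> {r \<in> carrier R. r \<otimes> a \<in> J}" using * by (simp add: R.m_comm)
qed (rule R.ring_axioms)

lemma ideal_insert:
  assumes J: "ideal J R" and a: "a \<in> carrier R"
  shows "ideal (PIdl a <+>\<^bsub>R\<^esub> J) R" "J \<subseteq> PIdl a <+>\<^bsub>R\<^esub> J" "a \<in> PIdl a <+>\<^bsub>R\<^esub> J"
    "PIdl a <+>\<^bsub>R\<^esub> J = {r \<otimes> a \<oplus> j | r j. r \<in> carrier R \<and> j \<in> J}"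
proof -
  show "ideal (PIdl a <+>\<^bsub>R\<^esub> J) R" by (intro R.add_ideals R.cgenideal_ideal a J)
  show *: "PIdl a <+>\<^bsub>R\<^esub> J = {r \<otimes> a \<oplus> j | r j. r \<in> carrier R \<and> j \<in> J}"
    by (auto simp: set_add_def' cgenideal_def)
  have J0: "\<zero> \<in> J" "J \<subseteq> carrier R" using additive_subgroup.zero_closed[OF ideal.axioms(1)[OF J]]
      additive_subgroup.a_subset[OF ideal.axioms(1)[OF J]] by blast+
  show "J \<subseteq> PIdl a <+>\<^bsub>R\<^esub> J"
  proof
    fix j assume "j \<in> J"
    then show "j \<in> PIdl a <+>\<^bsub>R\<^esub> J"
      unfolding * using a J0 by (intro CollectI exI[of _ \<zero>] exI[of _ j]) auto
  qed
  show "a \<in> PIdl a <+>\<^bsub>R\<^esub> J"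
    unfolding * using a J0 by (intro CollectI exI[of _ \<one>] exI[of _ \<zero>]) auto
qed

text \<open>
  That is, the dimension of \<open>R/J\<close> is at most \<open>d\<close>.
\<close>

definition chain_bound :: "'a set \<Rightarrow> nat \<Rightarrow> bool" where
  "chain_bound J d \<longleftrightarrow> (\<forall>n P. prime_chain R n P \<longrightarrow> J \<subseteq> P 0 \<longrightarrow> n \<le> d)"

lemma chain_bound_mono: "chain_bound J d \<Longrightarrow> J \<subseteq> K \<Longrightarrow> chain_bound K d"
  unfolding chain_bound_def by (meson subset_trans)

lemma chain_bound_above_prime:
  assumes "primeideal J R" "chain_bound J (Suc d)" "J \<subset> K" shows "chain_bound K d"
  unfolding chain_bound_def
proof (intro allI impI)
  fix n P assume P: "prime_chain R n P" "K \<subseteq> P 0"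
  have "prime_chain R (Suc n) (\<lambda>i. case i of 0 \<Rightarrow> J | Suc i \<Rightarrow> P i)"
    unfolding prime_chain_def
  proof (intro conjI allI impI)
    fix i assume "i \<le> Suc n"
    then show "primeideal (case i of 0 \<Rightarrow> J | Suc i \<Rightarrow> P i) R"
      using assms(1) P(1) by (cases i) (auto simp: prime_chain_def)
  next
    fix i assume "i < Suc n"
    then show "(case i of 0 \<Rightarrow> J | Suc i \<Rightarrow> P i) \<subset> (case Suc i of 0 \<Rightarrow> J | Suc i \<Rightarrow> P i)"
      using assms(3) P by (cases i) (auto simp: prime_chain_def)
  qed
  then have "Suc n \<le> Suc d" using assms(2) unfolding chain_bound_def by (metis nat.case(1) order_refl)
  then show "n \<le> d" by simp
qed

text \<open>
  The length of the cyclic module generated by the class of \<open>z\<close> modulo \<open>span S + F n\<close>. Keeping a set \<open>S\<close> of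
  relations, rather than passing to quotient modules, keeps everything inside one module \<open>M\<close>.
\<close>

definition cyclic_length :: "(nat \<Rightarrow> 'c set) \<Rightarrow> 'c \<Rightarrow> 'c set \<Rightarrow> nat \<Rightarrow> enat" where
  "cyclic_length F z S n = sub_length (span (insert z (S \<union> F n))) (span (S \<union> F n))"

text \<open>
  Additivity for the extension of the module generated by \<open>z\<close> modulo \<open>a z\<close> by the one generated by \<open>a z\<close>.
\<close>

lemma cyclic_length_split:
  assumes F: "\<And>n. submodule (F n) R M" and z: "z \<in> carrier M" and S: "S \<subseteq> carrier M" and a: "a \<in> carrier R"
  shows "cyclic_length F z S n = cyclic_length F z (insert (a \<odot>\<^bsub>M\<^esub> z) S) n + cyclic_length F (a \<odot>\<^bsub>M\<^esub> z) S n"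
proof -
  let ?T = "S \<union> F n" and ?y = "a \<odot>\<^bsub>M\<^esub> z"
  have T: "?T \<subseteq> carrier M" using S submoduleE(1)[OF F] by blast
  have y: "?y \<in> carrier M" using a z by simp
  have sub: "submodule (span (insert z ?T)) R M" "submodule (span (insert ?y ?T)) R M" "submodule (span ?T) R M"
    using T y z by (auto intro: span_submodule)
  have "z \<in> span (insert z ?T)" using span_superset[of "insert z ?T"] by blast
  then have yin: "?y \<in> span (insert z ?T)" using submoduleE(4)[OF sub(1)] a by blast
  have "insert ?y ?T \<subseteq> span (insert z ?T)" using yin span_superset[of "insert z ?T"] by blast
  then have le: "span (insert ?y ?T) \<subseteq> span (insert z ?T)" by (rule span_least[OF sub(1)])
  have "insert z (insert ?y ?T) \<subseteq> span (insert z ?T)" using yin span_superset[of "insert z ?T"] by blast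
  then have "span (insert z (insert ?y ?T)) = span (insert z ?T)"
    using span_least[OF sub(1)] span_mono[of "insert z ?T" "insert z (insert ?y ?T)"] by blast
  then have "cyclic_length F z (insert ?y S) n = sub_length (span (insert z ?T)) (span (insert ?y ?T))"
    by (simp add: cyclic_length_def)
  then show ?thesis
    unfolding cyclic_length_def using sub_length_add[OF sub(1,2,3)] le span_mono[of ?T "insert ?y ?T"] by auto
qed

lemma cyclic_length_smult_le:
  assumes F: "\<And>n. submodule (F n) R M" and x: "x \<in> carrier R" and xF: "\<And>y. y \<in> F n \<Longrightarrow> x \<odot>\<^bsub>M\<^esub> y \<in> F (Suc n)"
    and z: "z \<in> carrier M" and S: "S \<subseteq> carrier M"
  shows "cyclic_length F (x \<odot>\<^bsub>M\<^esub> z) S (Suc n) \<le> cyclic_length F z S n"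
  unfolding cyclic_length_def
proof (rule sub_length_smult_le[OF _ _ _ _ _ _ x])
  let ?T = "S \<union> F n" and ?T' = "S \<union> F (Suc n)"
  have T: "?T \<subseteq> carrier M" "?T' \<subseteq> carrier M" using S submoduleE(1)[OF F] by blast+
  have xz: "x \<odot>\<^bsub>M\<^esub> z \<in> carrier M" using x z by simp
  show sub: "submodule (span (insert z ?T)) R M" "submodule (span ?T) R M"
    "submodule (span (insert (x \<odot>\<^bsub>M\<^esub> z) ?T')) R M" and sub': "submodule (span ?T') R M"
    using T xz z by (auto intro: span_submodule)
  show "span ?T \<subseteq> span (insert z ?T)" "span ?T' \<subseteq> span (insert (x \<odot>\<^bsub>M\<^esub> z) ?T')"
    by (rule span_mono, blast)+
  have zT: "z \<in> span (insert z ?T)" using span_superset[of "insert z ?T"] by blast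
  have "span (insert (x \<odot>\<^bsub>M\<^esub> z) ?T') \<subseteq> span (insert (x \<odot>\<^bsub>M\<^esub> z) (span ?T'))"
    using span_superset[of ?T'] by (intro span_mono) blast
  then have sp: "span (insert (x \<odot>\<^bsub>M\<^esub> z) ?T') \<subseteq> {a \<odot>\<^bsub>M\<^esub> (x \<odot>\<^bsub>M\<^esub> z) \<oplus>\<^bsub>M\<^esub> b | a b. a \<in> carrier R \<and> b \<in> span ?T'}"
    using span_insert_submodule[OF sub' xz] by simp
  fix c assume "c \<in> span (insert (x \<odot>\<^bsub>M\<^esub> z) ?T')"
  then obtain a b where ab: "a \<in> carrier R" "b \<in> span ?T'" "c = a \<odot>\<^bsub>M\<^esub> (x \<odot>\<^bsub>M\<^esub> z) \<oplus>\<^bsub>M\<^esub> b" using sp by blast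
  have "a \<odot>\<^bsub>M\<^esub> (x \<odot>\<^bsub>M\<^esub> z) = x \<odot>\<^bsub>M\<^esub> (a \<odot>\<^bsub>M\<^esub> z)" using ab(1) x z by (simp add: smult_assoc1[symmetric] R.m_comm)
  moreover have "a \<odot>\<^bsub>M\<^esub> z \<in> span (insert z ?T)" using ab(1) zT submoduleE(4)[OF sub(1)] by blast
  ultimately show "\<exists>y\<in>span (insert z ?T). \<exists>b\<in>span ?T'. c = x \<odot>\<^bsub>M\<^esub> y \<oplus>\<^bsub>M\<^esub> b" using ab by metis
next
  let ?T = "S \<union> F n" and ?T' = "S \<union> F (Suc n)"
  have T: "?T \<subseteq> carrier M" "?T' \<subseteq> carrier M" using S submoduleE(1)[OF F] by blast+
  note sub' = span_submodule[OF T(2)]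
  have "?T \<subseteq> {y \<in> carrier M. x \<odot>\<^bsub>M\<^esub> y \<in> span ?T'}"
    using T xF span_superset[of ?T'] submoduleE(4)[OF sub' x] by blast
  then have "span ?T \<subseteq> {y \<in> carrier M. x \<odot>\<^bsub>M\<^esub> y \<in> span ?T'}"
    by (rule span_least[OF submodule_vimage_smult[OF sub' x]])
  then show "\<And>y. y \<in> span ?T \<Longrightarrow> x \<odot>\<^bsub>M\<^esub> y \<in> span ?T'" by blast
qed

lemma cyclic_length_eq_0:
  assumes "S \<subseteq> carrier M" "submodule (F n) R M" "z \<in> span (S \<union> F n)"
  shows "cyclic_length F z S n = 0"
proof -
  have T: "S \<union> F n \<subseteq> carrier M" using assms(1) submoduleE(1)[OF assms(2)] by blast
  have "insert z (S \<union> F n) \<subseteq> span (S \<union> F n)" using assms(3) span_superset[of "S \<union> F n"] by blast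
  then have "span (insert z (S \<union> F n)) = span (S \<union> F n)"
    using span_subset_span[OF T] span_mono[of "S \<union> F n" "insert z (S \<union> F n)"] by blast
  then show ?thesis unfolding cyclic_length_def using sub_length_self[OF span_submodule[OF T]] by simp
qed

text \<open>
  Noetherian induction on \<open>J\<close>, with \<open>d\<close> variable. If \<open>J\<close> is not prime, choose \<open>a, b\<close> outside \<open>J\<close> with
  \<open>a b \<in> J\<close> and split along \<open>a z\<close>: modulo \<open>a z\<close> the generator \<open>z\<close> is killed by \<open>J + (a)\<close>, and \<open>a z\<close> itself is
  killed by \<open>(J : a)\<close>, which contains \<open>b\<close>. If \<open>J = \<mm>\<close>, the length is at most \<open>1\<close>. If \<open>J\<close> is prime and different
  from \<open>\<mm>\<close>, choose \<open>x \<in> \<mm> - J\<close> and split along \<open>x z\<close>: since \<open>x (F n) \<subseteq> F (n + 1)\<close>, the second part at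
  \<open>n + 1\<close> is at most the whole at \<open>n\<close>, so the function is bounded by partial sums of one that grows like
  \<open>n\<^bsup>d - 1\<^esup>\<close>. The condition \<open>z \<in> F 0\<close> makes the length at \<open>0\<close> vanish, where these partial sums start.
\<close>

theorem cyclic_length_growth:
  assumes noeth: "noetherian_ring R" and max: "maximalideal \<mm> R"
    and local: "\<And>K. ideal K R \<Longrightarrow> K \<noteq> carrier R \<Longrightarrow> K \<subseteq> \<mm>"
    and F: "\<And>n. submodule (F n) R M"
    and mF: "\<And>n x y. x \<in> \<mm> \<Longrightarrow> y \<in> F n \<Longrightarrow> x \<odot>\<^bsub>M\<^esub> y \<in> F (Suc n)"
    and "ideal J R" and "chain_bound J d"
  shows "\<exists>C. \<forall>z S n. z \<in> F 0 \<and> S \<subseteq> carrier M \<and> (\<forall>j\<in>J. j \<odot>\<^bsub>M\<^esub> z \<in> span S) \<longrightarrow>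
    cyclic_length F z S n \<le> enat (C * Suc n ^ d)"
proof -
  interpret m: maximalideal \<mm> R by (rule max)
  interpret N: noetherian_ring R by (rule noeth)
  have F0: "F 0 \<subseteq> carrier M" using submoduleE(1)[OF F] .
  define Bd where "Bd J d C \<longleftrightarrow> (\<forall>z S n. z \<in> F 0 \<and> S \<subseteq> carrier M \<and> (\<forall>j\<in>J. j \<odot>\<^bsub>M\<^esub> z \<in> span S) \<longrightarrow>
    cyclic_length F z S n \<le> enat (C * Suc n ^ d))" for J d C
  have "\<forall>d. chain_bound J d \<longrightarrow> (\<exists>C. Bd J d C)"
  proof (rule N.noetherian_induct[OF \<open>ideal J R\<close>])
    fix J assume J: "ideal J R" and IH': "\<And>K. ideal K R \<Longrightarrow> J \<subset> K \<Longrightarrow> \<forall>d. chain_bound K d \<longrightarrow> (\<exists>C. Bd K d C)"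
    have IH: "\<exists>C. Bd K d C" if "ideal K R" "J \<subset> K" "chain_bound K d" for K d using IH' that by blast
    have Jc: "J \<subseteq> carrier R" using ideal.axioms(1)[OF J] additive_subgroup.a_subset by blast
    show "\<forall>d. chain_bound J d \<longrightarrow> (\<exists>C. Bd J d C)"
    proof (intro allI impI)
      fix d assume d: "chain_bound J d"
      consider (whole) "J = carrier R" | (not_prime) "J \<noteq> carrier R" "\<not> primeideal J R"
        | (max) "J = \<mm>" | (prime) "primeideal J R" "J \<noteq> \<mm>" by blast
      then show "\<exists>C. Bd J d C"
      proof cases
        case whole
        have "Bd J d 0"
          unfolding Bd_def
        proof (intro allI impI, elim conjE)
          fix z S n assume z: "z \<in> F 0" "S \<subseteq> carrier M" "\<forall>j\<in>J. j \<odot>\<^bsub>M\<^esub> z \<in> span S"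
          then have "\<one> \<odot>\<^bsub>M\<^esub> z \<in> span S" using whole by blast
          moreover have "\<one> \<odot>\<^bsub>M\<^esub> z = z" using z(1) F0 by (intro smult_one) blast
          ultimately have "z \<in> span (S \<union> F n)" using span_mono[of S "S \<union> F n"] by auto
          then show "cyclic_length F z S n \<le> enat (0 * Suc n ^ d)"
            using cyclic_length_eq_0[where F=F and n=n] z(2) F by simp
        qed
        then show ?thesis by blast
      next
        case not_prime
        obtain a b where ab: "a \<in> carrier R" "b \<in> carrier R" "a \<otimes> b \<in> J" "a \<notin> J" "b \<notin> J"
          using not_prime primeidealI[OF J R.is_cring] by metis
        let ?Q = "{r \<in> carrier R. r \<otimes> a \<in> J}" and ?K = "PIdl a <+>\<^bsub>R\<^esub> J"
        have "J \<subseteq> ?Q" using Jc ideal.I_r_closed[OF J] ab(1) by blast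
        moreover have "b \<in> ?Q" using ab by (simp add: R.m_comm)
        ultimately have Q: "J \<subset> ?Q" using ab(5) by blast
        have K: "J \<subset> ?K" using ideal_insert(2,3)[OF J ab(1)] ab(4) by blast
        obtain C where C: "Bd ?Q d C" using IH[OF ideal_colon[OF J ab(1)] Q] chain_bound_mono[OF d] Q by blast
        obtain C' where C': "Bd ?K d C'" using IH[OF ideal_insert(1)[OF J ab(1)] K] chain_bound_mono[OF d] K by blast
        have "Bd J d (C' + C)"
          unfolding Bd_def
        proof (intro allI impI, elim conjE)
          fix z S n assume z: "z \<in> F 0" "S \<subseteq> carrier M" "\<forall>j\<in>J. j \<odot>\<^bsub>M\<^esub> z \<in> span S"
          let ?y = "a \<odot>\<^bsub>M\<^esub> z" and ?S = "insert (a \<odot>\<^bsub>M\<^esub> z) S"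
          have zc: "z \<in> carrier M" using z(1) F0 by blast
          have y: "?y \<in> F 0" using submoduleE(4)[OF F ab(1) z(1)] .
          have S': "?S \<subseteq> carrier M" using y z(2) F0 by blast
          have "\<forall>j\<in>?Q. j \<odot>\<^bsub>M\<^esub> ?y \<in> span S" using z(3) ab(1) zc by (auto simp: smult_assoc1[symmetric])
          then have 1: "cyclic_length F ?y S n \<le> enat (C * Suc n ^ d)" using C y z(2) unfolding Bd_def by blast
          have "\<forall>j\<in>?K. j \<odot>\<^bsub>M\<^esub> z \<in> span ?S"
          proof
            fix k assume "k \<in> ?K"
            then obtain r j where k: "r \<in> carrier R" "j \<in> J" "k = r \<otimes> a \<oplus> j"
              unfolding ideal_insert(4)[OF J ab(1)] by blast
            have "k \<odot>\<^bsub>M\<^esub> z = r \<odot>\<^bsub>M\<^esub> ?y \<oplus>\<^bsub>M\<^esub> j \<odot>\<^bsub>M\<^esub> z"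
              using k Jc ab(1) zc by (auto simp: smult_l_distr smult_assoc1)
            moreover have "?y \<in> span ?S" "j \<odot>\<^bsub>M\<^esub> z \<in> span ?S"
              using span_superset[of ?S] z(3) k(2) span_mono[of S ?S] by auto
            ultimately show "k \<odot>\<^bsub>M\<^esub> z \<in> span ?S" using submoduleE(4,5)[OF span_submodule[OF S']] k(1) by simp
          qed
          then have 2: "cyclic_length F z ?S n \<le> enat (C' * Suc n ^ d)" using C' z(1) S' unfolding Bd_def by blast
          show "cyclic_length F z S n \<le> enat ((C' + C) * Suc n ^ d)"
            using add_mono[OF 2 1] cyclic_length_split[where F=F, OF F zc z(2) ab(1), of n]
            by (simp add: algebra_simps)
        qed
        then show ?thesis by blast
      next
        case max
        have "Bd J d 1"
          unfolding Bd_def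
        proof (intro allI impI, elim conjE)
          fix z S n assume z: "z \<in> F 0" "S \<subseteq> carrier M" "\<forall>j\<in>J. j \<odot>\<^bsub>M\<^esub> z \<in> span S"
          let ?T = "S \<union> F n"
          have T: "?T \<subseteq> carrier M" "z \<in> carrier M" using z F0 submoduleE(1)[OF F] by blast+
          have "span (insert z ?T) = span (insert z (span ?T))"
            using span_Un_span[of ?T "{z}"] T by simp
          moreover have "\<And>a. a \<in> \<mm> \<Longrightarrow> a \<odot>\<^bsub>M\<^esub> z \<in> span ?T" using z(3) max span_mono[of S ?T] by blast
          ultimately have "cyclic_length F z S n \<le> 1"
            using sub_length_insert_maximal[OF \<open>maximalideal \<mm> R\<close> span_submodule[OF T(1)] T(2)]
            by (auto simp: cyclic_length_def)
          also have "1 \<le> enat (1 * Suc n ^ d)" by (simp add: one_enat_def)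
          finally show "cyclic_length F z S n \<le> enat (1 * Suc n ^ d)" .
        qed
        then show ?thesis by blast
      next
        case prime
        have Jm: "J \<subset> \<mm>" using local[OF J] prime primeideal.I_notcarr[OF prime(1)] by blast
        then obtain x where x: "x \<in> \<mm>" "x \<notin> J" by blast
        have xc: "x \<in> carrier R" using x(1) m.Icarr by blast
        let ?K = "PIdl x <+>\<^bsub>R\<^esub> J"
        have K: "J \<subset> ?K" using ideal_insert(2,3)[OF J xc] x(2) by blast
        have "d \<noteq> 0"
        proof
          assume "d = 0"
          have "prime_chain R 1 (\<lambda>i. if i = 0 then J else \<mm>)"
            using prime(1) Jm R.maximalideal_prime[OF \<open>maximalideal \<mm> R\<close>] by (auto simp: prime_chain_def)
          then show False using d \<open>d = 0\<close> unfolding chain_bound_def by force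
        qed
        then obtain e where e: "d = Suc e" by (cases d) auto
        have "chain_bound ?K e" using chain_bound_above_prime[OF prime(1) _ K] d e by blast
        then obtain C where C: "Bd ?K e C" using IH[OF ideal_insert(1)[OF J xc] K] by blast
        have "Bd J d C"
          unfolding Bd_def
        proof (intro allI impI, elim conjE)
          fix z S n assume z: "z \<in> F 0" "S \<subseteq> carrier M" "\<forall>j\<in>J. j \<odot>\<^bsub>M\<^esub> z \<in> span S"
          let ?y = "x \<odot>\<^bsub>M\<^esub> z" and ?S = "insert (x \<odot>\<^bsub>M\<^esub> z) S"
          have zc: "z \<in> carrier M" using z(1) F0 by blast
          have S': "?S \<subseteq> carrier M" using xc zc z(2) by auto
          have "\<forall>j\<in>?K. j \<odot>\<^bsub>M\<^esub> z \<in> span ?S"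
          proof
            fix k assume "k \<in> ?K"
            then obtain r j where k: "r \<in> carrier R" "j \<in> J" "k = r \<otimes> x \<oplus> j"
              unfolding ideal_insert(4)[OF J xc] by blast
            have "k \<odot>\<^bsub>M\<^esub> z = r \<odot>\<^bsub>M\<^esub> ?y \<oplus>\<^bsub>M\<^esub> j \<odot>\<^bsub>M\<^esub> z"
              using k Jc xc zc by (auto simp: smult_l_distr smult_assoc1)
            moreover have "?y \<in> span ?S" "j \<odot>\<^bsub>M\<^esub> z \<in> span ?S"
              using span_superset[of ?S] z(3) k(2) span_mono[of S ?S] by auto
            ultimately show "k \<odot>\<^bsub>M\<^esub> z \<in> span ?S" using submoduleE(4,5)[OF span_submodule[OF S']] k(1) by simp
          qed
          then have step: "cyclic_length F z ?S n \<le> enat (C * Suc n ^ e)" for n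
            using C z(1) S' unfolding Bd_def by blast
          show "cyclic_length F z S n \<le> enat (C * Suc n ^ d)"
          proof (induction n)
            case 0
            have "z \<in> span (S \<union> F 0)" using z(1) span_superset[of "S \<union> F 0"] by blast
            then show ?case using cyclic_length_eq_0[where F=F and n=0, OF z(2) F] by simp
          next
            case (Suc n)
            have "cyclic_length F z S (Suc n) = cyclic_length F z ?S (Suc n) + cyclic_length F ?y S (Suc n)"
              by (rule cyclic_length_split[where F=F, OF F zc z(2) xc])
            also have "\<dots> \<le> enat (C * Suc (Suc n) ^ e) + enat (C * Suc n ^ d)"
              using cyclic_length_smult_le[where F=F, OF F xc mF[OF x(1)] zc z(2), of n] Suc.IH
              by (intro add_mono step) simp
            also have "\<dots> \<le> enat (C * Suc (Suc n) ^ d)"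
            proof -
              \<comment> \<open>With \<open>d = e + 1\<close> this is \<open>(n + 2)\<^sup>e + (n + 1) (n + 1)\<^sup>e \<le> (n + 2) (n + 2)\<^sup>e\<close>.\<close>
              have "Suc n ^ e \<le> Suc (Suc n) ^ e" by (intro power_mono) auto
              then have "Suc n * Suc n ^ e \<le> Suc n * Suc (Suc n) ^ e" by (rule mult_le_mono2)
              then have "Suc (Suc n) ^ e + Suc n ^ d \<le> Suc (Suc n) ^ d" by (simp add: e)
              then have "C * (Suc (Suc n) ^ e + Suc n ^ d) \<le> C * Suc (Suc n) ^ d" by (rule mult_le_mono2)
              then show ?thesis by (simp only: plus_enat_simps distrib_left[symmetric] enat_ord_simps)
            qed
            finally show ?case .
          qed
        qed
        then show ?thesis by blast
      qed
    qed
  qed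
  then show ?thesis using \<open>chain_bound J d\<close> unfolding Bd_def by blast
qed

end

context module
begin

section \<open>Quotient modules\<close>

lemma abelian_subgroup_submodule: "submodule L R M \<Longrightarrow> abelian_subgroup L M"
  using submodule.axioms(1) by (intro abelian_subgroupI3 additive_subgroupI M.abelian_group_axioms)

text \<open>
  The coset map is a surjective homomorphism onto the quotient. The additive group is verified from the group laws,
  since \<open>add_monoid\<close> of the quotient has the extra fields of a module record and so is not of the type of a factor
  group.
\<close>

lemma quotient_module_simps:
  assumes "submodule L R M"
  shows "carrier (quotient_module M L) = (\<lambda>x. L +>\<^bsub>M\<^esub> x) ` carrier M"
    and "\<And>x y. x \<in> carrier M \<Longrightarrow> y \<in> carrier M \<Longrightarrow>
      (L +>\<^bsub>M\<^esub> x) \<oplus>\<^bsub>quotient_module M L\<^esub> (L +>\<^bsub>M\<^esub> y) = L +>\<^bsub>M\<^esub> (x \<oplus>\<^bsub>M\<^esub> y)"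
    and "\<zero>\<^bsub>quotient_module M L\<^esub> = L +>\<^bsub>M\<^esub> \<zero>\<^bsub>M\<^esub>"
    and "\<And>a x. a \<in> carrier R \<Longrightarrow> x \<in> carrier M \<Longrightarrow>
      a \<odot>\<^bsub>quotient_module M L\<^esub> (L +>\<^bsub>M\<^esub> x) = L +>\<^bsub>M\<^esub> (a \<odot>\<^bsub>M\<^esub> x)"
    and "group (add_monoid (quotient_module M L))"
proof -
  interpret L: abelian_subgroup L M by (rule abelian_subgroup_submodule[OF assms])
  note L = submoduleE[OF assms]
  show carr: "carrier (quotient_module M L) = (\<lambda>x. L +>\<^bsub>M\<^esub> x) ` carrier M"
    by (auto simp: quotient_module_def A_RCOSETS_def')
  show add: "(L +>\<^bsub>M\<^esub> x) \<oplus>\<^bsub>quotient_module M L\<^esub> (L +>\<^bsub>M\<^esub> y) = L +>\<^bsub>M\<^esub> (x \<oplus>\<^bsub>M\<^esub> y)"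
    if "x \<in> carrier M" "y \<in> carrier M" for x y
    using L.a_rcos_sum that by (simp add: quotient_module_def)
  show zero: "\<zero>\<^bsub>quotient_module M L\<^esub> = L +>\<^bsub>M\<^esub> \<zero>\<^bsub>M\<^esub>"
    using L(1) by (simp add: quotient_module_def M.a_coset_add_zero)
  show "group (add_monoid (quotient_module M L))"
  proof (rule groupI)
    fix X assume "X \<in> carrier (add_monoid (quotient_module M L))"
    then obtain x where x: "x \<in> carrier M" "X = L +>\<^bsub>M\<^esub> x" by (auto simp: carr)
    show "\<exists>Y\<in>carrier (add_monoid (quotient_module M L)).
        Y \<otimes>\<^bsub>add_monoid (quotient_module M L)\<^esub> X = \<one>\<^bsub>add_monoid (quotient_module M L)\<^esub>"
      using x by (intro bexI[of _ "L +>\<^bsub>M\<^esub> (\<ominus>\<^bsub>M\<^esub> x)"]) (simp_all add: carr add zero M.l_neg)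
  qed (auto simp: carr add zero M.a_assoc)
  fix a x assume ax: "a \<in> carrier R" "x \<in> carrier M"
  have "L +>\<^bsub>M\<^esub> (a \<odot>\<^bsub>M\<^esub> y) = L +>\<^bsub>M\<^esub> (a \<odot>\<^bsub>M\<^esub> x)" if y: "y \<in> L +>\<^bsub>M\<^esub> x" for y
  proof -
    obtain l where l: "l \<in> L" "y = l \<oplus>\<^bsub>M\<^esub> x" using y by (auto simp: a_r_coset_def')
    have "a \<odot>\<^bsub>M\<^esub> y = a \<odot>\<^bsub>M\<^esub> l \<oplus>\<^bsub>M\<^esub> a \<odot>\<^bsub>M\<^esub> x" using l ax L(1) by (auto simp: smult_r_distr)
    then have "a \<odot>\<^bsub>M\<^esub> y \<in> L +>\<^bsub>M\<^esub> (a \<odot>\<^bsub>M\<^esub> x)" using L(4)[OF ax(1) l(1)] by (auto simp: a_r_coset_def')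
    then show ?thesis using ax by (intro L.a_repr_independence'[symmetric]) auto
  qed
  then have "(\<Union>y\<in>L +>\<^bsub>M\<^esub> x. L +>\<^bsub>M\<^esub> (a \<odot>\<^bsub>M\<^esub> y)) = (\<Union>y\<in>L +>\<^bsub>M\<^esub> x. L +>\<^bsub>M\<^esub> (a \<odot>\<^bsub>M\<^esub> x))"
    by (rule SUP_cong[OF refl])
  also have "\<dots> = L +>\<^bsub>M\<^esub> (a \<odot>\<^bsub>M\<^esub> x)" using L.a_rcos_self[OF ax(2)] by blast
  finally show "a \<odot>\<^bsub>quotient_module M L\<^esub> (L +>\<^bsub>M\<^esub> x) = L +>\<^bsub>M\<^esub> (a \<odot>\<^bsub>M\<^esub> x)"
    by (simp add: quotient_module_def)
qed

lemma quotient_module_inverse: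
  assumes "submodule L R M" "x \<in> carrier M"
  shows "inv\<^bsub>add_monoid (quotient_module M L)\<^esub> (L +>\<^bsub>M\<^esub> x) = L +>\<^bsub>M\<^esub> (\<ominus>\<^bsub>M\<^esub> x)"
proof -
  note Q = quotient_module_simps[OF assms(1)]
  show ?thesis
    using assms(2) by (intro group.inv_equality[OF Q(5)]) (simp_all add: Q M.l_neg)
qed

lemma submodule_quotient_image:
  assumes L: "submodule L R M" and K: "submodule K R M"
  shows "submodule ((\<lambda>x. L +>\<^bsub>M\<^esub> x) ` K) R (quotient_module M L)"
proof -
  note Q = quotient_module_simps[OF L] and K' = submoduleE[OF K]
  have Kc: "\<And>x. x \<in> K \<Longrightarrow> x \<in> carrier M" using K'(1) by blast
  show ?thesis
  proof (intro submodule.intro subgroup.intro submodule_axioms.intro)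
    show "(\<lambda>x. L +>\<^bsub>M\<^esub> x) ` K \<subseteq> carrier (add_monoid (quotient_module M L))"
      using K'(1) by (auto simp: Q)
    show "\<one>\<^bsub>add_monoid (quotient_module M L)\<^esub> \<in> (\<lambda>x. L +>\<^bsub>M\<^esub> x) ` K"
      using submodule_zero[OF K] by (simp add: Q)
    fix X assume "X \<in> (\<lambda>x. L +>\<^bsub>M\<^esub> x) ` K"
    then obtain x where x: "x \<in> K" "X = L +>\<^bsub>M\<^esub> x" by blast
    then show "inv\<^bsub>add_monoid (quotient_module M L)\<^esub> X \<in> (\<lambda>x. L +>\<^bsub>M\<^esub> x) ` K"
      using quotient_module_inverse[OF L Kc[OF x(1)]] K'(3) by blast
  qed (auto simp: Q Kc K')
qed

lemma submodule_quotient_vimage: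
  assumes L: "submodule L R M" and X: "submodule X R (quotient_module M L)"
  shows "submodule {x \<in> carrier M. L +>\<^bsub>M\<^esub> x \<in> X} R M" "L \<subseteq> {x \<in> carrier M. L +>\<^bsub>M\<^esub> x \<in> X}"
    "(\<lambda>x. L +>\<^bsub>M\<^esub> x) ` {x \<in> carrier M. L +>\<^bsub>M\<^esub> x \<in> X} = X"
proof -
  note Q = quotient_module_simps[OF L]
  note sg = submodule.axioms(1)[OF X]
  note X' = subgroup.subset[OF sg, simplified] subgroup.m_closed[OF sg, simplified] subgroup.one_closed[OF sg, simplified]
    subgroup.m_inv_closed[OF sg] submodule.smult_closed[OF X]
  show "submodule {x \<in> carrier M. L +>\<^bsub>M\<^esub> x \<in> X} R M"
  proof (rule submoduleI)
    show "\<zero>\<^bsub>M\<^esub> \<in> {x \<in> carrier M. L +>\<^bsub>M\<^esub> x \<in> X}" using X'(3) by (simp add: Q)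
    show "\<ominus>\<^bsub>M\<^esub> x \<in> {x \<in> carrier M. L +>\<^bsub>M\<^esub> x \<in> X}" if "x \<in> {x \<in> carrier M. L +>\<^bsub>M\<^esub> x \<in> X}" for x
      using that X'(4)[of "L +>\<^bsub>M\<^esub> x"] quotient_module_inverse[OF L, of x] by simp
    show "x \<oplus>\<^bsub>M\<^esub> y \<in> {x \<in> carrier M. L +>\<^bsub>M\<^esub> x \<in> X}"
      if "x \<in> {x \<in> carrier M. L +>\<^bsub>M\<^esub> x \<in> X}" "y \<in> {x \<in> carrier M. L +>\<^bsub>M\<^esub> x \<in> X}" for x y
      using that X'(2)[of "L +>\<^bsub>M\<^esub> x" "L +>\<^bsub>M\<^esub> y"] by (simp add: Q)
    show "a \<odot>\<^bsub>M\<^esub> x \<in> {x \<in> carrier M. L +>\<^bsub>M\<^esub> x \<in> X}"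
      if "a \<in> carrier R" "x \<in> {x \<in> carrier M. L +>\<^bsub>M\<^esub> x \<in> X}" for a x
      using that X'(5)[of a "L +>\<^bsub>M\<^esub> x"] by (simp add: Q)
  qed auto
  show "L \<subseteq> {x \<in> carrier M. L +>\<^bsub>M\<^esub> x \<in> X}"
  proof
    interpret L: abelian_subgroup L M by (rule abelian_subgroup_submodule[OF L])
    fix l assume l: "l \<in> L"
    have lc: "l \<in> carrier M" using submoduleE(1)[OF L] l by blast
    have "L +>\<^bsub>M\<^esub> l = L" using L.a_rcos_const[OF l] .
    moreover have "L \<in> X" using X'(3) submoduleE(1)[OF L] by (simp add: Q M.a_coset_add_zero)
    ultimately show "l \<in> {x \<in> carrier M. L +>\<^bsub>M\<^esub> x \<in> X}" using lc by simp
  qed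
  show "(\<lambda>x. L +>\<^bsub>M\<^esub> x) ` {x \<in> carrier M. L +>\<^bsub>M\<^esub> x \<in> X} = X"
    using X'(1) by (auto simp: Q)
qed

lemma quotient_image_strict:
  assumes L: "submodule L R M" and C: "submodule C R M" "L \<subseteq> C" and A: "submodule A R M" "C \<subset> A"
  shows "(\<lambda>x. L +>\<^bsub>M\<^esub> x) ` C \<subset> (\<lambda>x. L +>\<^bsub>M\<^esub> x) ` A"
proof -
  interpret L: abelian_subgroup L M by (rule abelian_subgroup_submodule[OF L])
  obtain a where a: "a \<in> A" "a \<notin> C" using A(2) by blast
  have "L +>\<^bsub>M\<^esub> a \<notin> (\<lambda>x. L +>\<^bsub>M\<^esub> x) ` C"
  proof
    assume "L +>\<^bsub>M\<^esub> a \<in> (\<lambda>x. L +>\<^bsub>M\<^esub> x) ` C"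
    then obtain c where c: "c \<in> C" "L +>\<^bsub>M\<^esub> a = L +>\<^bsub>M\<^esub> c" by blast
    have "a \<in> L +>\<^bsub>M\<^esub> c" using L.a_rcos_self[of a] a(1) submoduleE(1)[OF A(1)] c(2) by auto
    then obtain l where "l \<in> L" "a = l \<oplus>\<^bsub>M\<^esub> c" by (auto simp: a_r_coset_def')
    then show False using a(2) c(1) C(2) submoduleE(5)[OF C(1)] by blast
  qed
  then show ?thesis using A(2) a(1) by blast
qed

theorem module_length_quotient:
  assumes L: "submodule L R M"
  shows "module_length R (quotient_module M L) = sub_length (carrier M) L"
proof -
  let ?Q = "quotient_module M L" and ?q = "\<lambda>x. L +>\<^bsub>M\<^esub> x"
  have "(\<exists>N. (\<forall>i\<le>n. submodule (N i) R ?Q) \<and> (\<forall>i<n. N i \<subset> N (Suc i))) \<longleftrightarrow> sub_chain n (carrier M) L" for n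
  proof
    assume "\<exists>N. (\<forall>i\<le>n. submodule (N i) R ?Q) \<and> (\<forall>i<n. N i \<subset> N (Suc i))"
    then obtain N where N: "\<And>i. i \<le> n \<Longrightarrow> submodule (N i) R ?Q" "\<And>i. i < n \<Longrightarrow> N i \<subset> N (Suc i)" by blast
    let ?p = "\<lambda>i. {x \<in> carrier M. ?q x \<in> N i}"
    have p: "submodule (?p i) R M" "L \<subseteq> ?p i" "?q ` ?p i = N i" if "i \<le> n" for i
      using submodule_quotient_vimage[OF L N(1)[OF that]] by blast+
    have "sub_chain i (?p i) L" if "i \<le> n" for i
      using that
    proof (induction i)
      case 0
      then show ?case using p[of 0] L by simp
    next
      case (Suc i)
      have NS: "N i \<subset> N (Suc i)" using N(2) Suc.prems by simp
      then have "?p i \<subseteq> ?p (Suc i)" by blast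
      moreover have "?p i \<noteq> ?p (Suc i)"
      proof
        assume "?p i = ?p (Suc i)"
        then have "?q ` ?p i = ?q ` ?p (Suc i)" by (rule arg_cong)
        then show False using p(3)[of i] p(3)[of "Suc i"] Suc.prems NS by simp
      qed
      ultimately have "?p i \<subset> ?p (Suc i)" by (rule psubsetI)
      moreover have "sub_chain i (?p i) L" using Suc by simp
      ultimately show ?case unfolding sub_chain.simps using p(1)[OF Suc.prems] by blast
    qed
    then show "sub_chain n (carrier M) L" using sub_chain_raise[of n "?p n" L] carrier_is_submodule by auto
  next
    have "\<exists>N. (\<forall>i\<le>n. submodule (N i) R ?Q) \<and> (\<forall>i<n. N i \<subset> N (Suc i)) \<and> N n = ?q ` A"
      if "sub_chain n A L" for A
      using that
    proof (induction n arbitrary: A)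
      case 0
      then show ?case using submodule_quotient_image[OF L] by (intro exI[of _ "\<lambda>_. ?q ` A"]) auto
    next
      case (Suc n)
      then obtain C where C: "submodule A R M" "C \<subset> A" "sub_chain n C L" unfolding sub_chain.simps by blast
      obtain N where N: "\<And>i. i \<le> n \<Longrightarrow> submodule (N i) R ?Q" "\<And>i. i < n \<Longrightarrow> N i \<subset> N (Suc i)" "N n = ?q ` C"
        using Suc.IH[OF C(3)] by blast
      have "?q ` C \<subset> ?q ` A" using quotient_image_strict[OF L _ _ C(1,2)] sub_chain_bounds[OF C(3)] by blast
      then have "(N(Suc n := ?q ` A)) i \<subset> (N(Suc n := ?q ` A)) (Suc i)" if "i < Suc n" for i
        using N(2)[of i] N(3) that by (cases "i = n") simp_all
      moreover have "submodule ((N(Suc n := ?q ` A)) i) R ?Q" if "i \<le> Suc n" for i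
        using N(1)[of i] submodule_quotient_image[OF L C(1)] that by (cases "i = Suc n") simp_all
      moreover have "(N(Suc n := ?q ` A)) (Suc n) = ?q ` A" by simp
      ultimately show ?case by (intro exI[of _ "N(Suc n := ?q ` A)"] conjI allI impI)
    qed
    note lift = this
    assume "sub_chain n (carrier M) L"
    from lift[OF this] show "\<exists>N. (\<forall>i\<le>n. submodule (N i) R ?Q) \<and> (\<forall>i<n. N i \<subset> N (Suc i))"
      by (rule ex_forward) (elim conjE, intro conjI)
  qed
  then show ?thesis unfolding module_length_def sub_length_def by simp
qed

lemma submodule_of_submodule_iff:
  assumes N: "submodule N R M"
  shows "submodule K R (M\<lparr>carrier := N\<rparr>) \<longleftrightarrow> submodule K R M \<and> K \<subseteq> N"
proof
  interpret N: module R "M\<lparr>carrier := N\<rparr>" by (rule submodule.submodule_is_module[OF N module_axioms])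
  { assume K: "submodule K R (M\<lparr>carrier := N\<rparr>)"
    then have KN: "K \<subseteq> N" using N.submoduleE(1) by fastforce
    have "module R (M\<lparr>carrier := K\<rparr>)" using submodule.submodule_is_module[OF K N.module_axioms] by simp
    then show "submodule K R M \<and> K \<subseteq> N"
      using module_incl_imp_submodule[of K] KN submoduleE(1)[OF N] by blast }
  { assume K: "submodule K R M \<and> K \<subseteq> N"
    then have "module R (M\<lparr>carrier := K\<rparr>)" using submodule.submodule_is_module[OF _ module_axioms] by blast
    then show "submodule K R (M\<lparr>carrier := N\<rparr>)" using N.module_incl_imp_submodule[of K] K by simp }
qed

text \<open>
  The length of a subquotient is measured by chains of submodules of \<open>M\<close> itself, by the correspondence between
  submodules of the quotient and submodules above \<open>L\<close>.
\<close>

theorem quotient_length_eq_sub_length: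
  assumes N: "submodule N R M" and L: "submodule L R M" "L \<subseteq> N"
  shows "quotient_length R M N L = sub_length N L"
proof -
  interpret N: module R "M\<lparr>carrier := N\<rparr>" by (rule submodule.submodule_is_module[OF N module_axioms])
  have chain: "N.sub_chain n A B \<longleftrightarrow> sub_chain n A B" if "A \<subseteq> N" for n A B
    using that
  proof (induction n arbitrary: A)
    case 0
    then show ?case by (auto simp: submodule_of_submodule_iff[OF N])
  next
    case (Suc n)
    then have "C \<subset> A \<Longrightarrow> N.sub_chain n C B \<longleftrightarrow> sub_chain n C B" for C by blast
    then show ?case using Suc.prems submodule_of_submodule_iff[OF N, of A] by auto
  qed
  have "quotient_length R M N L = N.sub_length N L"
    unfolding quotient_length_def using N.module_length_quotient[of L] L by (simp add: submodule_of_submodule_iff[OF N])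
  also have "\<dots> = sub_length N L" unfolding N.sub_length_def sub_length_def by (simp add: chain)
  finally show ?thesis .
qed

section \<open>Products of ideals and submodules\<close>

lemma ideal_times_generators:
  assumes "J \<subseteq> carrier R" "N \<subseteq> carrier M"
  shows "{a \<odot>\<^bsub>M\<^esub> x | a x. a \<in> J \<and> x \<in> N} \<subseteq> carrier M"
  using assms by blast

lemma ideal_times_submodule:
  "J \<subseteq> carrier R \<Longrightarrow> N \<subseteq> carrier M \<Longrightarrow> submodule (ideal_times R M J N) R M"
  unfolding ideal_times_def by (intro span_submodule ideal_times_generators)

lemma smult_in_ideal_times: "a \<in> J \<Longrightarrow> x \<in> N \<Longrightarrow> a \<odot>\<^bsub>M\<^esub> x \<in> ideal_times R M J N"
  unfolding ideal_times_def by (rule subsetD[OF span_superset]) blast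

lemma ideal_times_least:
  assumes "submodule H R M" "\<And>a x. a \<in> J \<Longrightarrow> x \<in> N \<Longrightarrow> a \<odot>\<^bsub>M\<^esub> x \<in> H"
  shows "ideal_times R M J N \<subseteq> H"
  unfolding ideal_times_def using assms by (intro span_least) auto

lemma ideal_carrier: "ideal J R \<Longrightarrow> J \<subseteq> carrier R"
  using ideal.axioms(1) additive_subgroup.a_subset by blast

lemma ideal_times_subset: "J \<subseteq> carrier R \<Longrightarrow> submodule N R M \<Longrightarrow> ideal_times R M J N \<subseteq> N"
  using submoduleE(4) by (intro ideal_times_least) auto

lemma ideal_times_carrier:
  assumes N: "submodule N R M" shows "ideal_times R M (carrier R) N = N"
proof
  show "N \<subseteq> ideal_times R M (carrier R) N"
  proof
    fix x assume x: "x \<in> N"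
    then have "\<one> \<odot>\<^bsub>M\<^esub> x = x" using submoduleE(1)[OF N] by (intro smult_one) blast
    then show "x \<in> ideal_times R M (carrier R) N"
      using smult_in_ideal_times[OF R.one_closed x] by simp
  qed
qed (rule ideal_times_subset[OF subset_refl N])

lemma ideal_times_prod:
  assumes I: "ideal I R" and J: "ideal J R" and N: "submodule N R M"
  shows "ideal_times R M (I \<cdot>\<^bsub>R\<^esub> J) N = ideal_times R M I (ideal_times R M J N)" (is "?L = ?R")
proof
  note c = ideal_carrier[OF I] ideal_carrier[OF J] submoduleE(1)[OF N]
  have JN: "ideal_times R M J N \<subseteq> carrier M" using ideal_times_submodule[OF c(2,3)] by (rule submoduleE(1))
  have R: "submodule ?R R M" by (rule ideal_times_submodule[OF c(1) JN])
  have IJ: "I \<cdot>\<^bsub>R\<^esub> J \<subseteq> carrier R" by (rule R.ideal_prod_in_carrier[OF I J])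
  have L: "submodule ?L R M" by (rule ideal_times_submodule[OF IJ c(3)])
  show "?L \<subseteq> ?R"
  proof (rule ideal_times_least[OF R])
    fix a x assume "a \<in> I \<cdot>\<^bsub>R\<^esub> J" and x: "x \<in> N"
    then show "a \<odot>\<^bsub>M\<^esub> x \<in> ?R"
    proof (induction rule: ideal_prod.induct)
      case (prod i j)
      have "(i \<otimes> j) \<odot>\<^bsub>M\<^esub> x = i \<odot>\<^bsub>M\<^esub> (j \<odot>\<^bsub>M\<^esub> x)" using prod x c by (intro smult_assoc1) auto
      then show ?case using prod x by (auto intro: smult_in_ideal_times)
    next
      case (sum s t)
      have "(s \<oplus> t) \<odot>\<^bsub>M\<^esub> x = s \<odot>\<^bsub>M\<^esub> x \<oplus>\<^bsub>M\<^esub> t \<odot>\<^bsub>M\<^esub> x"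
        using sum.hyps IJ x c(3) by (intro smult_l_distr) auto
      then show ?case using sum.IH x submoduleE(5)[OF R] by simp
    qed
  qed
  show "?R \<subseteq> ?L"
  proof (rule ideal_times_least[OF L])
    fix i y assume i: "i \<in> I" and y: "y \<in> ideal_times R M J N"
    have ic: "i \<in> carrier R" using i c(1) by blast
    have "ideal_times R M J N \<subseteq> {y \<in> carrier M. i \<odot>\<^bsub>M\<^esub> y \<in> ?L}"
    proof (rule ideal_times_least[OF submodule_vimage_smult[OF L ic]])
      fix j x assume jx: "j \<in> J" "x \<in> N"
      then have jxc: "j \<in> carrier R" "x \<in> carrier M" using c by blast+
      have "(i \<otimes> j) \<odot>\<^bsub>M\<^esub> x = i \<odot>\<^bsub>M\<^esub> (j \<odot>\<^bsub>M\<^esub> x)" using jxc ic by (intro smult_assoc1)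
      then show "j \<odot>\<^bsub>M\<^esub> x \<in> {y \<in> carrier M. i \<odot>\<^bsub>M\<^esub> y \<in> ?L}"
        using smult_in_ideal_times[OF ideal_prod.prod[OF i jx(1), of R] jx(2)] jxc by simp
    qed
    then show "i \<odot>\<^bsub>M\<^esub> y \<in> ?L" using y by blast
  qed
qed

text \<open>
  Both closures are removed by a minimality argument: first in the module variable for a fixed generator \<open>x\<close>,
  then in the ring variable for a fixed element of the span.
\<close>

lemma ideal_times_genideal_span:
  assumes X: "X \<subseteq> carrier R" and S: "S \<subseteq> carrier M"
  shows "ideal_times R M (Idl X) (span S) = span {x \<odot>\<^bsub>M\<^esub> s | x s. x \<in> X \<and> s \<in> S}" (is "_ = span ?G")
proof
  have G: "?G \<subseteq> carrier M" using X S by blast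
  note H = span_submodule[OF G]
  have Sc: "span S \<subseteq> carrier M" by (rule span_carrier[OF S])
  show "ideal_times R M (Idl X) (span S) \<subseteq> span ?G"
  proof (rule ideal_times_least[OF H])
    fix a y assume a: "a \<in> Idl X" and y: "y \<in> span S"
    have "x \<odot>\<^bsub>M\<^esub> y \<in> span ?G" if x: "x \<in> X" for x
    proof -
      have xc: "x \<in> carrier R" using x X by blast
      have "span S \<subseteq> {y \<in> carrier M. x \<odot>\<^bsub>M\<^esub> y \<in> span ?G}"
        using S x span_superset[of ?G] by (intro span_least[OF submodule_vimage_smult[OF H xc]]) blast
      then show ?thesis using y by blast
    qed
    then have "X \<subseteq> {r \<in> carrier R. r \<odot>\<^bsub>M\<^esub> y \<in> span ?G}" using X by blast
    then have "Idl X \<subseteq> {r \<in> carrier R. r \<odot>\<^bsub>M\<^esub> y \<in> span ?G}"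
      using y Sc by (intro R.genideal_minimal ideal_transporter[OF H]) blast
    then show "a \<odot>\<^bsub>M\<^esub> y \<in> span ?G" using a by blast
  qed
  have "?G \<subseteq> ideal_times R M (Idl X) (span S)"
    using R.genideal_self[OF X] span_superset[of S] smult_in_ideal_times by blast
  then show "span ?G \<subseteq> ideal_times R M (Idl X) (span S)"
    by (intro span_least ideal_times_submodule ideal_carrier R.genideal_ideal X Sc)
qed

lemma ideal_power_ideal: "ideal J R \<Longrightarrow> ideal (ideal_power R J n) R"
  by (induction n) (simp_all add: ideals_set_def R.oneideal R.ideal_prod_is_ideal)

lemma ideal_times_power_0: "submodule N R M \<Longrightarrow> ideal_times R M (ideal_power R J 0) N = N"
  by (simp add: ideals_set_def ideal_times_carrier)

lemma ideal_times_power_Suc: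
  assumes J: "ideal J R" and N: "submodule N R M"
  shows "ideal_times R M (ideal_power R J (Suc n)) N = ideal_times R M J (ideal_times R M (ideal_power R J n) N)"
proof -
  have "ideal_power R J (Suc n) = J \<cdot>\<^bsub>R\<^esub> ideal_power R J n"
    using R.ideal_prod_commute[OF J ideal_power_ideal[OF J, of n]] by (simp add: ideals_set_def)
  then show ?thesis using ideal_times_prod[OF J ideal_power_ideal[OF J] N] by simp
qed

lemma ideal_times_power_submodule:
  "ideal J R \<Longrightarrow> submodule N R M \<Longrightarrow> submodule (ideal_times R M (ideal_power R J n) N) R M"
  by (intro ideal_times_submodule ideal_carrier ideal_power_ideal submoduleE(1))

lemma ideal_times_power_finitely_spanned:
  assumes noeth: "noetherian_ring R" and J: "ideal J R"
    and S: "finite S" "S \<subseteq> carrier M"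
  shows "\<exists>T. finite T \<and> T \<subseteq> carrier M \<and> ideal_times R M (ideal_power R J n) (span S) = span T"
proof (induction n)
  case 0
  then show ?case using S ideal_times_power_0[OF span_submodule[OF S(2)]] by blast
next
  case (Suc n)
  then obtain T where T: "finite T" "T \<subseteq> carrier M" "ideal_times R M (ideal_power R J n) (span S) = span T" by blast
  obtain X where X: "X \<subseteq> carrier R" "finite X" "J = Idl X" using noetherian_ring.finetely_gen[OF noeth J] by blast
  have "{x \<odot>\<^bsub>M\<^esub> s | x s. x \<in> X \<and> s \<in> T} = (\<lambda>(x, s). x \<odot>\<^bsub>M\<^esub> s) ` (X \<times> T)" by auto
  then have "finite {x \<odot>\<^bsub>M\<^esub> s | x s. x \<in> X \<and> s \<in> T}" using X(2) T(1) by simp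
  moreover have "{x \<odot>\<^bsub>M\<^esub> s | x s. x \<in> X \<and> s \<in> T} \<subseteq> carrier M" using X(1) T(2) by blast
  moreover have "ideal_times R M (ideal_power R J (Suc n)) (span S) = span {x \<odot>\<^bsub>M\<^esub> s | x s. x \<in> X \<and> s \<in> T}"
    using ideal_times_power_Suc[OF J span_submodule[OF S(2)], of n] ideal_times_genideal_span[OF X(1) T(2)]
    by (simp only: T(3) X(3)[symmetric])
  ultimately show ?case by blast
qed

end

section \<open>Standard monomials\<close>

text \<open>
  The lexicographic order is compatible with multiplication by a variable, as required of a monomial order.
\<close>

lemma list_less_update_Suc:
  fixes es fs :: "nat list"
  assumes "fs < es" "length fs = length es"
  shows "fs[i := Suc (fs ! i)] < es[i := Suc (es ! i)]"
  using assms
proof (induction es arbitrary: fs i)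
  case (Cons e es)
  then obtain f fs' where "fs = f # fs'" by (cases fs) auto
  then show ?case using Cons by (cases i) auto
qed simp

context module
begin

fun monomial :: "'a list \<Rightarrow> nat list \<Rightarrow> 'a" where
  "monomial (x # xs) (e # es) = x [^]\<^bsub>R\<^esub> e \<otimes>\<^bsub>R\<^esub> monomial xs es"
| "monomial xs es = \<one>\<^bsub>R\<^esub>"

lemma monomial_closed: "set xs \<subseteq> carrier R \<Longrightarrow> monomial xs es \<in> carrier R"
  by (induction xs es rule: monomial.induct) auto

lemma monomial_zero: "monomial xs (replicate n 0) = \<one>"
proof (induction xs arbitrary: n)
  case (Cons x xs)
  then show ?case by (cases n) auto
qed simp

lemma monomial_update:
  assumes "set xs \<subseteq> carrier R" "length es = length xs" "i < length xs"
  shows "monomial xs (es[i := Suc (es ! i)]) = xs ! i \<otimes> monomial xs es"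
  using assms
proof (induction xs arbitrary: es i)
  case (Cons x xs)
  then obtain e es' where es: "es = e # es'" by (cases es) auto
  have x: "x \<in> carrier R" "x [^] e \<in> carrier R" "monomial xs es' \<in> carrier R"
    using Cons.prems monomial_closed by auto
  show ?case
  proof (cases i)
    case 0
    then show ?thesis using x by (simp add: es R.m_ac)
  next
    case (Suc k)
    then have k: "k < length xs" "xs ! k \<in> carrier R" using Cons.prems by auto
    have "monomial xs (es'[k := Suc (es' ! k)]) = xs ! k \<otimes> monomial xs es'"
      using Cons k es by (intro Cons.IH) auto
    then show ?thesis using Suc x k by (simp add: es R.m_lcomm)
  qed
qed simp

lemma Suc_exponent:
  assumes "sum_list es = Suc n"
  obtains fs i where "i < length es" "length fs = length es" "sum_list fs = n" "es = fs[i := Suc (fs ! i)]"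
proof -
  obtain i where i: "i < length es" "es ! i > 0"
    using assms by (metis in_set_conv_nth nat.distinct(1) not_gr_zero sum_list_eq_0_iff)
  let ?fs = "es[i := es ! i - 1]"
  have "sum_list ?fs = n" using i assms by (simp add: sum_list_update)
  moreover have "es = ?fs[i := Suc (?fs ! i)]" using i by simp
  ultimately show thesis using that[of i ?fs] i by simp
qed

lemma sum_list_update_Suc: "i < length es \<Longrightarrow> sum_list (es[i := Suc (es ! i)]) = Suc (sum_list es)"
  by (induction es arbitrary: i) (auto split: nat.split)

lemma ideal_times_power_monomials:
  assumes xs: "set xs \<subseteq> carrier R" and Z: "Z \<subseteq> carrier M"
  shows "ideal_times R M (ideal_power R (Idl (set xs)) n) (span Z)
    = span {monomial xs es \<odot>\<^bsub>M\<^esub> z | es z. length es = length xs \<and> sum_list es = n \<and> z \<in> Z}"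
proof (induction n)
  case 0
  have "{monomial xs es \<odot>\<^bsub>M\<^esub> z | es z. length es = length xs \<and> sum_list es = 0 \<and> z \<in> Z} = Z"
  proof -
    have "monomial xs es \<odot>\<^bsub>M\<^esub> z = z" if "length es = length xs" "sum_list es = 0" "z \<in> Z" for es z
    proof -
      have "es = replicate (length xs) 0" using that by (metis replicate_eqI sum_list_eq_0_iff)
      then show ?thesis using monomial_zero smult_one Z that(3) by auto
    qed
    note act = this
    show ?thesis
    proof (intro equalityI subsetI)
      fix z assume z: "z \<in> Z"
      then have "z = monomial xs (replicate (length xs) 0) \<odot>\<^bsub>M\<^esub> z" using act[of "replicate (length xs) 0" z] by simp
      then show "z \<in> {monomial xs es \<odot>\<^bsub>M\<^esub> z | es z. length es = length xs \<and> sum_list es = 0 \<and> z \<in> Z}"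
        using z by (intro CollectI exI[of _ "replicate (length xs) 0"] exI[of _ z]) simp
    qed (use act in auto)
  qed
  then show ?case using ideal_times_power_0[OF span_submodule[OF Z]] by simp
next
  case (Suc n)
  let ?G = "\<lambda>n. {monomial xs es \<odot>\<^bsub>M\<^esub> z | es z. length es = length xs \<and> sum_list es = n \<and> z \<in> Z}"
  have G: "?G n \<subseteq> carrier M" using monomial_closed[OF xs] Z by blast
  have step: "(xs ! i) \<odot>\<^bsub>M\<^esub> (monomial xs es \<odot>\<^bsub>M\<^esub> z) = monomial xs (es[i := Suc (es ! i)]) \<odot>\<^bsub>M\<^esub> z"
    if "length es = length xs" "i < length xs" "z \<in> Z" for i es z
  proof -
    have "xs ! i \<in> carrier R" "z \<in> carrier M" using that xs Z by auto
    then show ?thesis using monomial_update[OF xs that(1,2)] monomial_closed[OF xs] by (simp add: smult_assoc1)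
  qed
  have "{x \<odot>\<^bsub>M\<^esub> s | x s. x \<in> set xs \<and> s \<in> ?G n} = ?G (Suc n)"
  proof (intro equalityI subsetI)
    fix y assume "y \<in> {x \<odot>\<^bsub>M\<^esub> s | x s. x \<in> set xs \<and> s \<in> ?G n}"
    then obtain i es z where "i < length xs" "length es = length xs" "sum_list es = n" "z \<in> Z"
      "y = (xs ! i) \<odot>\<^bsub>M\<^esub> (monomial xs es \<odot>\<^bsub>M\<^esub> z)" by (auto simp: in_set_conv_nth)
    then show "y \<in> ?G (Suc n)"
      using step[of es i z] sum_list_update_Suc[of i es]
      by (intro CollectI exI[of _ "es[i := Suc (es ! i)]"] exI[of _ z]) simp
  next
    fix y assume "y \<in> ?G (Suc n)"
    then obtain es z where y: "length es = length xs" "sum_list es = Suc n" "z \<in> Z" "y = monomial xs es \<odot>\<^bsub>M\<^esub> z" by blast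
    obtain i fs where fs: "i < length es" "length fs = length es" "sum_list fs = n" "es = fs[i := Suc (fs ! i)]"
      using y(2) by (rule Suc_exponent)
    have len: "length fs = length xs" "i < length xs" using y(1) fs(1,2) by simp_all
    have "y = (xs ! i) \<odot>\<^bsub>M\<^esub> (monomial xs fs \<odot>\<^bsub>M\<^esub> z)"
      unfolding step[OF len y(3)] fs(4)[symmetric] by (rule y(4))
    moreover have "xs ! i \<in> set xs" "monomial xs fs \<odot>\<^bsub>M\<^esub> z \<in> ?G n" using len fs(3) y(3) by auto
    ultimately show "y \<in> {x \<odot>\<^bsub>M\<^esub> s | x s. x \<in> set xs \<and> s \<in> ?G n}" by blast
  qed
  then have "ideal_times R M (Idl (set xs)) (span (?G n)) = span (?G (Suc n))"
    using ideal_times_genideal_span[OF xs G] by simp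
  then show ?case
    using ideal_times_power_Suc[OF R.genideal_ideal[OF xs] span_submodule[OF Z], of n] by (simp only: Suc.IH)
qed

text \<open>
  Add the vectors \<open>v i\<close> in increasing order. Each step is killed by \<open>\<mm>\<close>, so it adds \<open>1\<close> to the length, or
  \<open>0\<close> when \<open>v i\<close> lies in the span of its predecessors.
\<close>

lemma sub_length_standard_count:
  fixes v :: "'i :: linorder \<Rightarrow> 'c"
  assumes max: "maximalideal \<mm> R" and B: "submodule B R M" and "finite X"
    and "\<And>i. i \<in> X \<Longrightarrow> v i \<in> carrier M" and "\<And>a i. a \<in> \<mm> \<Longrightarrow> i \<in> X \<Longrightarrow> a \<odot>\<^bsub>M\<^esub> v i \<in> B"
  shows "sub_length (span (v ` X \<union> B)) B = enat (card {i \<in> X. v i \<notin> span (v ` {j \<in> X. j < i} \<union> B)})"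
  using assms(3-)
proof (induction X rule: finite_linorder_max_induct)
  case empty
  then show ?case using sub_length_self[OF B] span_eq_self[OF B] by (simp add: zero_enat_def)
next
  case (insert b A)
  note Bc = submoduleE(1)[OF B]
  let ?W = "span (v ` A \<union> B)" and ?P = "\<lambda>X i. v i \<notin> span (v ` {j \<in> X. j < i} \<union> B)"
  have carr: "v ` A \<union> B \<subseteq> carrier M" "v b \<in> carrier M" using insert.prems(1) Bc by auto
  have W: "submodule ?W R M" by (rule span_submodule[OF carr(1)])
  have BW: "B \<subseteq> ?W" using span_superset[of "v ` A \<union> B"] by blast
  have eq: "span (v ` insert b A \<union> B) = span (insert (v b) ?W)"
    using span_Un_span[of "v ` A \<union> B" "{v b}"] carr by simp
  have V: "submodule (span (insert (v b) ?W)) R M" using carr submoduleE(1)[OF W] by (intro span_submodule) auto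
  have WV: "?W \<subseteq> span (insert (v b) ?W)" using span_superset[of "insert (v b) ?W"] by blast
  have IH: "sub_length ?W B = enat (card {i \<in> A. ?P A i})" using insert.IH insert.prems by blast
  have top: "sub_length (span (insert (v b) ?W)) ?W = (if v b \<in> ?W then 0 else 1)"
    using insert.prems(2) BW by (intro sub_length_insert_maximal[OF max W carr(2)]) blast
  have below: "{j \<in> insert b A. j < i} = {j \<in> A. j < i}" if "i \<in> A" for i using insert.hyps(2) that by force
  have "{j \<in> insert b A. j < b} = A" using insert.hyps(2) by auto
  then have Qb: "?P (insert b A) b \<longleftrightarrow> v b \<notin> ?W" by simp
  have QA: "{i \<in> A. ?P (insert b A) i} = {i \<in> A. ?P A i}" by (intro Collect_cong conj_cong refl) (simp only: below)
  have split: "{i \<in> insert b A. Q i} = (if Q b then insert b {i \<in> A. Q i} else {i \<in> A. Q i})" for Q by auto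
  have "{i \<in> insert b A. ?P (insert b A) i} = (if v b \<in> ?W then {i \<in> A. ?P A i} else insert b {i \<in> A. ?P A i})"
    unfolding split[of "?P (insert b A)"] QA using Qb by simp
  moreover have "b \<notin> A" using insert.hyps(2) by blast
  ultimately have "card {i \<in> insert b A. ?P (insert b A) i} = (if v b \<in> ?W then 0 else 1) + card {i \<in> A. ?P A i}"
    using insert.hyps(1) by simp
  then show ?case
    unfolding eq using sub_length_add[OF V W B BW WV] IH top by (simp add: one_enat_def zero_enat_def)
qed

text \<open>
  A monomial times a generator is indexed by the list \<open>j # es\<close> of the index of the generator and the exponents,
  and ordered lexicographically. If \<open>j # es\<close> is nonstandard, multiplying the relation that witnesses this by
  \<open>x\<^sub>i\<close> shows that raising the \<open>i\<close>-th exponent gives a nonstandard index again; here the compatibility of the order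
  with multiplication is used. So for each \<open>j\<close> the nonstandard exponents form an up-closed set \<open>U j\<close>, and the
  length of the \<open>n\<close>-th layer counts the exponents of degree \<open>n\<close> outside these sets.
\<close>

theorem associated_graded_eventually_poly:
  fixes F :: "nat \<Rightarrow> 'c set"
  assumes max: "maximalideal \<mm> R" and xs: "set xs \<subseteq> \<mm>" and zs: "set zs \<subseteq> carrier M"
    and F: "\<And>n. submodule (F n) R M"
    and mF: "\<And>n x y. x \<in> \<mm> \<Longrightarrow> y \<in> F n \<Longrightarrow> x \<odot>\<^bsub>M\<^esub> y \<in> F (Suc n)"
    and gen: "\<And>n. F n = span ({monomial xs es \<odot>\<^bsub>M\<^esub> z | es z. length es = length xs \<and> sum_list es = n \<and> z \<in> set zs} \<union> F (Suc n))"
  shows "\<exists>g. (\<forall>n. sub_length (F n) (F (Suc n)) = enat (g n)) \<and> eventually_poly (\<lambda>n. real (g n))"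
proof -
  interpret m: maximalideal \<mm> R by (rule max)
  have xc: "set xs \<subseteq> carrier R" using xs m.Icarr by blast
  define t where "t = length xs"
  define v where "v \<iota> = monomial xs (tl \<iota>) \<odot>\<^bsub>M\<^esub> (zs ! hd \<iota>)" for \<iota>
  define X where "X n = {j # es | j es. j < length zs \<and> length es = t \<and> sum_list es = n}" for n
  define nonstd where "nonstd n \<iota> \<longleftrightarrow> v \<iota> \<in> span (v ` {\<kappa> \<in> X n. \<kappa> < \<iota>} \<union> F (Suc n))" for n \<iota>
  define U where "U j = {es. length es = t \<and> nonstd (sum_list es) (j # es)}" for j
  have finX: "finite (X n)" for n
  proof -
    have "X n = (\<lambda>(j, es). j # es) ` ({..<length zs} \<times> {es. length es = t \<and> sum_list es = n})" by (auto simp: X_def)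
    then show ?thesis using finite_lists_sum by simp
  qed
  have vX: "v ` X n = {monomial xs es \<odot>\<^bsub>M\<^esub> z | es z. length es = length xs \<and> sum_list es = n \<and> z \<in> set zs}" for n
  proof (intro equalityI subsetI)
    fix y assume "y \<in> {monomial xs es \<odot>\<^bsub>M\<^esub> z | es z. length es = length xs \<and> sum_list es = n \<and> z \<in> set zs}"
    then obtain es j where "length es = t" "sum_list es = n" "j < length zs" "y = v (j # es)"
      by (auto simp: v_def t_def in_set_conv_nth)
    then show "y \<in> v ` X n" unfolding X_def by blast
  next
    fix y assume "y \<in> v ` X n"
    then obtain \<iota> where \<iota>: "\<iota> \<in> X n" "y = v \<iota>" by blast
    then obtain j es where "j < length zs" "length es = length xs" "sum_list es = n" "\<iota> = j # es"
      unfolding X_def t_def by blast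
    moreover from this have "y = monomial xs es \<odot>\<^bsub>M\<^esub> (zs ! j)" "zs ! j \<in> set zs" using \<iota>(2) by (simp_all add: v_def)
    ultimately show "y \<in> {monomial xs es \<odot>\<^bsub>M\<^esub> z | es z. length es = length xs \<and> sum_list es = n \<and> z \<in> set zs}"
      by blast
  qed
  have Feq: "F n = span (v ` X n \<union> F (Suc n))" for n unfolding vX by (rule gen)
  have vF: "v \<iota> \<in> F n" if "\<iota> \<in> X n" for \<iota> n
    using Feq[of n] span_superset[of "v ` X n \<union> F (Suc n)"] that by blast
  have vc: "v \<iota> \<in> carrier M" if "\<iota> \<in> X n" for \<iota> n using vF[OF that] submoduleE(1)[OF F] by blast
  have vstep: "v (j # es[i := Suc (es ! i)]) = (xs ! i) \<odot>\<^bsub>M\<^esub> v (j # es)"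
    if "j < length zs" "length es = t" "i < t" for i j es
  proof -
    have "xs ! i \<in> carrier R" "zs ! j \<in> carrier M" using that xc zs by (auto simp: t_def)
    then show ?thesis
      using monomial_update[OF xc, of es i] monomial_closed[OF xc] that by (simp add: v_def t_def smult_assoc1)
  qed
  have up: "up_closed t (U j)" if j: "j < length zs" for j
    unfolding up_closed_def
  proof (intro ballI conjI allI impI)
    fix es assume es: "es \<in> U j"
    then show len: "length es = t" by (simp add: U_def)
    fix i assume i: "i < t"
    define n where "n = sum_list es"
    have xi: "xs ! i \<in> \<mm>" "xs ! i \<in> carrier R" using xs xc i by (auto simp: t_def)
    let ?es = "es[i := Suc (es ! i)]"
    let ?W = "\<lambda>n \<iota>. v ` {\<kappa> \<in> X n. \<kappa> < \<iota>} \<union> F (Suc n)"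
    have Wc: "?W n \<iota> \<subseteq> carrier M" for n \<iota> using vc submoduleE(1)[OF F] by blast
    have sub: "submodule (span (?W (Suc n) (j # ?es))) R M" by (rule span_submodule[OF Wc])
    have "?W n (j # es) \<subseteq> {y \<in> carrier M. (xs ! i) \<odot>\<^bsub>M\<^esub> y \<in> span (?W (Suc n) (j # ?es))}"
    proof
      fix y assume y: "y \<in> ?W n (j # es)"
      have "(xs ! i) \<odot>\<^bsub>M\<^esub> y \<in> ?W (Suc n) (j # ?es)"
      proof (cases "y \<in> F (Suc n)")
        case True
        then show ?thesis using mF[OF xi(1)] by blast
      next
        case False
        then obtain l fs where fs: "l < length zs" "length fs = t" "sum_list fs = n" "l # fs < j # es" "y = v (l # fs)"
          using y by (auto simp: X_def)
        have "l # fs[i := Suc (fs ! i)] < j # ?es"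
          using list_less_update_Suc[OF fs(4), of "Suc i"] fs(2) len by simp
        moreover have "l # fs[i := Suc (fs ! i)] \<in> X (Suc n)"
          using fs i sum_list_update_Suc[of i fs] by (simp add: X_def)
        moreover have "(xs ! i) \<odot>\<^bsub>M\<^esub> y = v (l # fs[i := Suc (fs ! i)])" using vstep[OF fs(1,2) i] fs(5) by simp
        ultimately show ?thesis by blast
      qed
      then show "y \<in> {y \<in> carrier M. (xs ! i) \<odot>\<^bsub>M\<^esub> y \<in> span (?W (Suc n) (j # ?es))}"
        using y Wc span_superset[of "?W (Suc n) (j # ?es)"] by blast
    qed
    then have "span (?W n (j # es)) \<subseteq> {y \<in> carrier M. (xs ! i) \<odot>\<^bsub>M\<^esub> y \<in> span (?W (Suc n) (j # ?es))}"
      by (rule span_least[OF submodule_vimage_smult[OF sub xi(2)]])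
    moreover have "v (j # es) \<in> span (?W n (j # es))" using es by (simp add: U_def nonstd_def n_def)
    ultimately have "nonstd (Suc n) (j # ?es)" unfolding nonstd_def vstep[OF j len i] by blast
    then show "?es \<in> U j" using len i by (simp add: U_def sum_list_update_Suc n_def)
  qed
  define g where "g n = (\<Sum>j<length zs. complement_count t (U j) n)" for n
  have "sub_length (F n) (F (Suc n)) = enat (g n)" for n
  proof -
    have "{\<iota> \<in> X n. \<not> nonstd n \<iota>} = (\<Union>j\<in>{..<length zs}. (#) j ` {es. length es = t \<and> sum_list es = n \<and> es \<notin> U j})"
      by (auto simp: X_def U_def image_iff)
    then have "card {\<iota> \<in> X n. \<not> nonstd n \<iota>} = card (\<Union>j\<in>{..<length zs}. (#) j ` {es. length es = t \<and> sum_list es = n \<and> es \<notin> U j})"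
      by simp
    also have "\<dots> = (\<Sum>j<length zs. card ((#) j ` {es. length es = t \<and> sum_list es = n \<and> es \<notin> U j}))"
    proof (rule card_UN_disjoint)
      show "\<forall>j\<in>{..<length zs}. finite ((#) j ` {es. length es = t \<and> sum_list es = n \<and> es \<notin> U j})"
        by (intro ballI finite_imageI finite_subset[OF _ finite_lists_sum[of t n]]) blast
    qed auto
    also have "\<dots> = g n" unfolding g_def by (intro sum.cong refl) (simp add: card_image complement_count_def)
    finally have "card {\<iota> \<in> X n. \<not> nonstd n \<iota>} = g n" .
    moreover have "sub_length (span (v ` X n \<union> F (Suc n))) (F (Suc n)) = enat (card {\<iota> \<in> X n. \<not> nonstd n \<iota>})"
      unfolding nonstd_def using vc mF vF by (intro sub_length_standard_count[OF max F finX]) blast+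
    ultimately show ?thesis by (simp only: Feq[of n, symmetric])
  qed
  moreover have "eventually_poly (\<lambda>n. real (g n))"
    unfolding g_def of_nat_sum by (intro eventually_poly_sum complement_count_eventually_poly up) simp
  ultimately show ?thesis by blast
qed

section \<open>The Hilbert--Samuel function\<close>

lemma sub_length_telescope:
  assumes F: "\<And>n. submodule (F n) R M" and dec: "\<And>n. F (Suc n) \<subseteq> F n"
  shows "sub_length (F 0) (F n) = (\<Sum>i<n. sub_length (F i) (F (Suc i)))"
proof (induction n)
  case 0
  then show ?case by (simp add: sub_length_self F)
next
  case (Suc n)
  have "F n \<subseteq> F 0" using dec by (simp add: lift_Suc_antimono_le)
  then show ?case using sub_length_add[OF F[of 0] F[of n] F[of "Suc n"] dec] Suc by simp
qed

lemma annihilator_ideal: "ideal (annihilator R M) R"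
proof (rule idealI)
  show "subgroup (annihilator R M) (add_monoid R)"
    by unfold_locales (auto simp: annihilator_def smult_l_distr smult_l_minus a_inv_def[symmetric])
  fix a x assume a: "a \<in> annihilator R M" "x \<in> carrier R"
  then show "x \<otimes> a \<in> annihilator R M" by (auto simp: annihilator_def smult_assoc1)
  then show "a \<otimes> x \<in> annihilator R M" using a by (simp add: annihilator_def R.m_comm)
qed (rule R.ring_axioms)

text \<open>
  The function is a sum of the lengths of the layers, hence eventually a polynomial, and adding the generators in
  \<open>Z\<close> one at a time bounds it by a sum of growth functions of cyclic modules. Every such cyclic module is killed by
  the annihilator of \<open>M\<close>, so the growth bound forces the degree to be at most \<open>d\<close>.
\<close>

theorem hilbert_samuel_polynomial:
  assumes noeth: "noetherian_ring R" and max: "maximalideal \<mm> R"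
    and local: "\<And>K. ideal K R \<Longrightarrow> K \<noteq> carrier R \<Longrightarrow> K \<subseteq> \<mm>"
    and Z: "finite Z" "Z \<subseteq> carrier M" and B: "submodule B R M" "B \<subseteq> span Z"
    and d: "chain_bound (annihilator R M) d"
  shows "\<exists>f T N. (\<forall>n. sub_length (span Z) (span (ideal_times R M (ideal_power R \<mm> n) (span Z) \<union> B)) = enat (f n)) \<and>
    degree T \<le> d \<and> (\<forall>n\<ge>N. real (f n) = poly T (real n))"
proof -
  interpret m: maximalideal \<mm> R by (rule max)
  let ?A = "span Z"
  define E where "E n = ideal_times R M (ideal_power R \<mm> n) ?A" for n
  define F where "F n = span (E n \<union> B)" for n
  have A: "submodule ?A R M" by (rule span_submodule[OF Z(2)])
  have E: "submodule (E n) R M" for n unfolding E_def by (rule ideal_times_power_submodule[OF m.is_ideal A])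
  have EBc: "E n \<union> B \<subseteq> carrier M" for n using submoduleE(1)[OF E] submoduleE(1)[OF B(1)] by blast
  have F: "submodule (F n) R M" for n unfolding F_def by (rule span_submodule[OF EBc])
  have ESuc: "E (Suc n) = ideal_times R M \<mm> (E n)" for n unfolding E_def by (rule ideal_times_power_Suc[OF m.is_ideal A])
  have mc: "\<mm> \<subseteq> carrier R" by (rule ideal_carrier[OF m.is_ideal])
  have Edec: "E (Suc n) \<subseteq> E n" for n unfolding ESuc by (rule ideal_times_subset[OF mc E])
  have E0: "E 0 = ?A" unfolding E_def by (rule ideal_times_power_0[OF A])
  have Fdec: "F (Suc n) \<subseteq> F n" for n unfolding F_def using Edec by (intro span_mono) blast
  have F0: "F 0 = ?A" unfolding F_def E0 using B(2) span_eq_self[OF A] by (simp add: Un_absorb2)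
  have mF: "x \<odot>\<^bsub>M\<^esub> y \<in> F (Suc n)" if x: "x \<in> \<mm>" and y: "y \<in> F n" for x y n
  proof -
    have xc: "x \<in> carrier R" using x mc by blast
    have "E n \<union> B \<subseteq> {y \<in> carrier M. x \<odot>\<^bsub>M\<^esub> y \<in> F (Suc n)}"
    proof
      fix y assume y: "y \<in> E n \<union> B"
      have "x \<odot>\<^bsub>M\<^esub> y \<in> E (Suc n) \<union> B"
        using y submoduleE(4)[OF B(1) xc] smult_in_ideal_times[OF x] unfolding ESuc by blast
      then show "y \<in> {y \<in> carrier M. x \<odot>\<^bsub>M\<^esub> y \<in> F (Suc n)}"
        using y EBc span_superset[of "E (Suc n) \<union> B"] unfolding F_def by blast
    qed
    then have "F n \<subseteq> {y \<in> carrier M. x \<odot>\<^bsub>M\<^esub> y \<in> F (Suc n)}"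
      unfolding F_def[of n] by (rule span_least[OF submodule_vimage_smult[OF F xc]])
    then show ?thesis using y by blast
  qed
  obtain S where S: "S \<subseteq> carrier R" "finite S" "\<mm> = Idl S"
    using noetherian_ring.finetely_gen[OF noeth m.is_ideal] by blast
  obtain xs where xs: "set xs = S" using finite_list[OF S(2)] by blast
  obtain zs where zs: "set zs = Z" using finite_list[OF Z(1)] by blast
  let ?G = "\<lambda>n. {monomial xs es \<odot>\<^bsub>M\<^esub> z | es z. length es = length xs \<and> sum_list es = n \<and> z \<in> set zs}"
  have EG: "E n = span (?G n)" for n
    unfolding E_def S(3) xs[symmetric] zs by (rule ideal_times_power_monomials) (use S(1) xs Z(2) in auto)
  have gen: "F n = span (?G n \<union> F (Suc n))" for n
  proof
    have Gc: "?G n \<subseteq> carrier M" using EG[of n] span_superset[of "?G n"] submoduleE(1)[OF E] by blast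
    have GF: "?G n \<union> F (Suc n) \<subseteq> carrier M" using Gc submoduleE(1)[OF F] by blast
    have "B \<subseteq> F (Suc n)" unfolding F_def using span_superset by blast
    then have "E n \<union> B \<subseteq> span (?G n \<union> F (Suc n))"
      using EG[of n] span_mono[of "?G n" "?G n \<union> F (Suc n)"] span_superset[of "?G n \<union> F (Suc n)"] by blast
    then show "F n \<subseteq> span (?G n \<union> F (Suc n))" unfolding F_def[of n] by (rule span_subset_span[OF GF])
    have "?G n \<subseteq> F n" using EG[of n] span_superset[of "?G n"] span_superset[of "E n \<union> B"] unfolding F_def by blast
    then show "span (?G n \<union> F (Suc n)) \<subseteq> F n" using Fdec by (intro span_least[OF F]) blast
  qed
  have "set xs \<subseteq> \<mm>" using R.genideal_self[OF S(1)] S(3) xs by blast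
  moreover have "set zs \<subseteq> carrier M" using Z(2) zs by blast
  ultimately obtain g where g: "\<And>n. sub_length (F n) (F (Suc n)) = enat (g n)" "eventually_poly (\<lambda>n. real (g n))"
    using associated_graded_eventually_poly[where F = F, OF max _ _ F mF gen] by blast
  define f where "f n = (\<Sum>i<n. g i)" for n
  have f: "sub_length ?A (F n) = enat (f n)" for n
  proof -
    have "sub_length ?A (F n) = (\<Sum>i<n. enat (g i))" using sub_length_telescope[where F = F, OF F Fdec, of n] g(1) F0 by simp
    also have "\<dots> = enat (f n)" unfolding f_def by (induction n) (auto simp: zero_enat_def)
    finally show ?thesis .
  qed
  have "eventually_poly (\<lambda>n. real (f n))" unfolding f_def of_nat_sum by (rule eventually_poly_partial_sums[OF g(2)])
  then obtain T N where T: "\<And>n. n \<ge> N \<Longrightarrow> real (f n) = poly T (real n)" unfolding eventually_poly_def by blast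
  obtain C where C: "\<And>z S n. z \<in> F 0 \<Longrightarrow> S \<subseteq> carrier M \<Longrightarrow> \<forall>j\<in>annihilator R M. j \<odot>\<^bsub>M\<^esub> z \<in> span S \<Longrightarrow>
      cyclic_length F z S n \<le> enat (C * Suc n ^ d)"
    using cyclic_length_growth[where F = F, OF noeth max local F mF annihilator_ideal d] by blast
  have bound: "sub_length (span (Z' \<union> F n)) (F n) \<le> enat (card Z' * (C * Suc n ^ d))" if "finite Z'" "Z' \<subseteq> Z" for Z' n
    using that
  proof (induction Z')
    case empty
    then show ?case using span_eq_self[OF F] sub_length_self[OF F] by (simp add: zero_enat_def)
  next
    case (insert z Z')
    have Z': "Z' \<subseteq> carrier M" "z \<in> carrier M" using insert.prems Z(2) by auto
    have Fc: "F n \<subseteq> carrier M" by (rule submoduleE(1)[OF F])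
    have "\<forall>j\<in>annihilator R M. j \<odot>\<^bsub>M\<^esub> z \<in> span Z'"
      using Z' submodule_zero[OF span_submodule[OF Z'(1)]] by (auto simp: annihilator_def)
    then have "cyclic_length F z Z' n \<le> enat (C * Suc n ^ d)"
      using C Z'(1) F0 span_superset[of Z] insert.prems by blast
    moreover have "sub_length (span (insert z Z' \<union> F n)) (F n) = cyclic_length F z Z' n + sub_length (span (Z' \<union> F n)) (F n)"
      unfolding cyclic_length_def Un_insert_left
    proof (rule sub_length_add)
      show "submodule (span (insert z (Z' \<union> F n))) R M" "submodule (span (Z' \<union> F n)) R M"
        using Z' Fc by (auto intro: span_submodule)
      show "F n \<subseteq> span (Z' \<union> F n)" using span_superset[of "Z' \<union> F n"] by blast
      show "span (Z' \<union> F n) \<subseteq> span (insert z (Z' \<union> F n))" by (rule span_mono) blast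
    qed (rule F)
    ultimately have "sub_length (span (insert z Z' \<union> F n)) (F n) \<le> enat (C * Suc n ^ d) + enat (card Z' * (C * Suc n ^ d))"
      using insert.IH insert.prems add_mono by fastforce
    then show ?case using insert.hyps by simp
  qed
  have fbound: "real (f n) \<le> real (card Z * C) * real (Suc n) ^ d" for n
  proof -
    have "F n \<subseteq> ?A" using Fdec F0 by (metis lift_Suc_antimono_le zero_le)
    then have "span (Z \<union> F n) = ?A"
      using span_subset_span[OF Z(2), of "Z \<union> F n"] span_superset[of Z] span_mono[of Z "Z \<union> F n"] by blast
    then have "f n \<le> card Z * (C * Suc n ^ d)" using bound[OF Z(1) subset_refl, of n] f by simp
    then show ?thesis by (metis of_nat_le_iff of_nat_mult of_nat_power mult.assoc)
  qed
  have "degree T \<le> d"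
    by (rule poly_degree_le_growth[of N T "real (card Z * C)"]) (use T fbound in \<open>metis of_nat_0_le_iff\<close>)+
  then show ?thesis using f T unfolding F_def E_def by blast
qed

end

section \<open>Dimension and chains of primes\<close>

lemma (in cring) prime_quotient_image:
  assumes K: "ideal K R" and P: "primeideal P R" "K \<subseteq> P"
  shows "primeideal ((+>) K ` P) (R Quot K)"
    and "\<And>x. x \<in> carrier R \<Longrightarrow> K +> x \<in> (+>) K ` P \<Longrightarrow> x \<in> P"
proof -
  interpret P: primeideal P R by (rule P(1))
  interpret K: ideal K R by (rule K)
  show mem: "x \<in> P" if x: "x \<in> carrier R" "K +> x \<in> (+>) K ` P" for x
  proof -
    obtain p where p: "p \<in> P" "K +> x = K +> p" using x(2) by blast
    have "x \<in> K +> p" using K.a_rcos_self[OF x(1)] p(2) by simp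
    then obtain k where "k \<in> K" "x = k \<oplus> p" by (auto simp: a_r_coset_def')
    then show ?thesis using P(2) p(1) by auto
  qed
  have carr: "carrier (R Quot K) = (+>) K ` carrier R" by (auto simp: FactRing_def A_RCOSETS_def')
  show "primeideal ((+>) K ` P) (R Quot K)"
  proof (rule primeidealI)
    show "ideal ((+>) K ` P) (R Quot K)" by (rule ring_ideal_imp_quot_ideal[OF K P.is_ideal])
    show "cring (R Quot K)" by (rule K.quotient_is_cring[OF is_cring])
    show "carrier (R Quot K) \<noteq> (+>) K ` P"
    proof
      assume "carrier (R Quot K) = (+>) K ` P"
      then have "x \<in> P" if "x \<in> carrier R" for x using mem[OF that] carr that by blast
      then show False using P.I_notcarr P.a_subset by blast
    qed
    fix X Y assume XY: "X \<in> carrier (R Quot K)" "Y \<in> carrier (R Quot K)" "X \<otimes>\<^bsub>R Quot K\<^esub> Y \<in> (+>) K ` P"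
    then obtain x y where xy: "x \<in> carrier R" "y \<in> carrier R" "X = K +> x" "Y = K +> y" by (auto simp: carr)
    have "X \<otimes>\<^bsub>R Quot K\<^esub> Y = K +> (x \<otimes> y)" using K.rcoset_mult_add[OF xy(1,2)] xy by (simp add: FactRing_def)
    then have "x \<otimes> y \<in> P" using mem[OF m_closed[OF xy(1,2)]] XY(3) by simp
    then show "X \<in> (+>) K ` P \<or> Y \<in> (+>) K ` P" using P.I_prime xy by blast
  qed
qed

lemma (in module) chain_bound_module_dim:
  assumes "module_dim R M = enat D" shows "chain_bound (annihilator R M) D"
  unfolding chain_bound_def
proof (intro allI impI)
  let ?K = "annihilator R M"
  note K = annihilator_ideal
  fix n P assume P: "prime_chain R n P" "?K \<subseteq> P 0"
  have le: "P 0 \<subseteq> P i" if "i \<le> n" for i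
    using that
  proof (induction i)
    case (Suc i)
    then have "P i \<subset> P (Suc i)" using P(1) by (simp add: prime_chain_def)
    then show ?case using Suc by auto
  qed simp
  have prime: "primeideal (P i) R" "?K \<subseteq> P i" if "i \<le> n" for i
    using P le[OF that] that by (auto simp: prime_chain_def)
  have "prime_chain (R Quot ?K) n (\<lambda>i. (+>) ?K ` P i)"
    unfolding prime_chain_def
  proof (intro conjI allI impI)
    fix i assume "i \<le> n"
    then show "primeideal ((+>) ?K ` P i) (R Quot ?K)" by (intro R.prime_quotient_image[OF K] prime)
  next
    fix i assume i: "i < n"
    then have lt: "P i \<subset> P (Suc i)" using P(1) by (simp add: prime_chain_def)
    then obtain x where x: "x \<in> P (Suc i)" "x \<notin> P i" by blast
    have xc: "x \<in> carrier R" using x(1) prime(1)[of "Suc i"] i ideal_carrier[OF primeideal.axioms(1)] by auto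
    have "?K +> x \<notin> (+>) ?K ` P i" using R.prime_quotient_image(2)[OF K prime[of i] xc] x(2) i by auto
    then show "(+>) ?K ` P i \<subset> (+>) ?K ` P (Suc i)" using lt x(1) by blast
  qed
  then have "enat n \<le> krull_dim (R Quot ?K)" unfolding krull_dim_def by (intro SUP_upper) blast
  then show "n \<le> D" using assms by (simp add: module_dim_def)
qed

section \<open>Equality of the multiplicities\<close>

text \<open>
  It remains to identify \<open>H\<close> and its sum transform with lengths of layers of the filtrations
  \<open>F u n = \<mm>\<^sup>n I\<^sup>u M + I\<^bsup>u + 1\<^esup> M\<close>: the directional function at \<open>(r, u)\<close> is the length of \<open>F u 0 / F u (r + 1)\<close>.
\<close>

theorem proposition3p2:
  fixes R :: "('a, 'c) ring_scheme" and \<mm> :: "'a set"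
    and M :: "('a, 'b, 'd) module_scheme" and I :: "'a set" and D i :: nat
  assumes "noetherian_local_ring R \<mm>"
    and "module R M"
    and "finitely_generated_module R M"
    and "carrier M \<noteq> {\<zero>\<^bsub>M\<^esub>}"
    and "module_dim R M = enat D"
    and "D \<ge> 1"
    and "ideal I R"
    and "I \<noteq> carrier R"
    and "module_height R M I > 0"
    and "1 \<le> i" and "i \<le> D"
  shows "directional_multiplicity R \<mm> M I i = multiplicity_sequence R \<mm> M I i"
proof -
  interpret local: noetherian_local_ring R \<mm> by fact
  interpret module R M by fact
  note noeth = local.noetherian_ring_axioms and max = local.maximal
  interpret m: maximalideal \<mm> R by (rule max)
  have in_max: "K \<subseteq> \<mm>" if "ideal K R" "K \<noteq> carrier R" for K
    using local.proper_ideal_below_maximal[OF that] local.unique_maximal by blast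
  obtain S where S: "finite S" "S \<subseteq> carrier M" "span S = carrier M"
    using assms(3) unfolding finitely_generated_module_def by blast
  obtain d where d: "D = Suc d" using assms(6) by (cases D) auto
  have chains: "chain_bound (annihilator R M) (Suc d)" using chain_bound_module_dim assms(5) d by blast
  define IM where "IM u = ideal_times R M (ideal_power R I u) (carrier M)" for u
  define F where "F u n = span (ideal_times R M (ideal_power R \<mm> n) (IM u) \<union> IM (Suc u))" for u n
  have IM: "submodule (IM u) R M" for u
    unfolding IM_def by (rule ideal_times_power_submodule[OF assms(7) carrier_is_submodule])
  have IM_dec: "IM (Suc u) \<subseteq> IM u" for u
    unfolding IM_def ideal_times_power_Suc[OF assms(7) carrier_is_submodule]
    by (rule ideal_times_subset[OF ideal_carrier[OF assms(7)] IM[unfolded IM_def]])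
  have E: "submodule (ideal_times R M (ideal_power R \<mm> n) (IM u)) R M" for n u
    by (rule ideal_times_power_submodule[OF max[THEN maximalideal.axioms(1)] IM])
  have Edec: "ideal_times R M (ideal_power R \<mm> (Suc n)) (IM u) \<subseteq> ideal_times R M (ideal_power R \<mm> n) (IM u)" for n u
    unfolding ideal_times_power_Suc[OF m.is_ideal IM] by (rule ideal_times_subset[OF ideal_carrier[OF m.is_ideal] E])
  have Feq: "F u n = ideal_times R M (ideal_power R \<mm> n) (IM u) <+>\<^bsub>M\<^esub> IM (Suc u)" for u n
    unfolding F_def by (rule span_Un_submodules[OF E IM])
  have F: "submodule (F u n) R M" for u n unfolding Feq by (rule submodule_set_add[OF E IM])
  have Fdec: "F u (Suc n) \<subseteq> F u n" for u n unfolding F_def using Edec by (intro span_mono) blast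
  have F0: "F u 0 = IM u" for u
    unfolding F_def ideal_times_power_0[OF IM] using IM_dec span_eq_self[OF IM] by (simp add: Un_absorb2)
  have "\<exists>f T N. (\<forall>n. sub_length (IM u) (F u n) = enat (f n)) \<and> degree T \<le> Suc d \<and>
      (\<forall>n\<ge>N. real (f n) = poly T (real n))" for u
  proof -
    obtain Z where Z: "finite Z" "Z \<subseteq> carrier M" "IM u = span Z"
      using ideal_times_power_finitely_spanned[OF noeth assms(7) S(1,2), of u] unfolding S(3) IM_def by blast
    have le: "IM (Suc u) \<subseteq> span Z" using IM_dec[of u] Z(3) by blast
    show ?thesis
      unfolding F_def Z(3)
      by (rule hilbert_samuel_polynomial[OF noeth max in_max Z(1,2) IM le chains])
  qed
  then obtain f where f: "\<And>u n. sub_length (IM u) (F u n) = enat (f u n)"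
    and fT: "\<And>u. \<exists>T N. degree T \<le> Suc d \<and> (\<forall>n\<ge>N. real (f u n) = poly T (real n))" by metis
  define H where "H r u = f u (Suc r)" for r u
  define h where "h r u = (\<Sum>b\<le>u. H r b)" for r u
  have FIM: "F u n \<subseteq> IM u" for u n using Fdec F0 by (metis lift_Suc_antimono_le zero_le)
  have H: "directional_hilbert R \<mm> M I r u = enat (H r u)" for r u
  proof -
    have "directional_hilbert R \<mm> M I r u = quotient_length R M (IM u) (F u (Suc r))"
      unfolding directional_hilbert_def Let_def Feq IM_def by simp
    then show ?thesis using quotient_length_eq_sub_length[OF IM F FIM] f by (simp add: H_def)
  qed
  have h: "bigraded_hilbert_sum R \<mm> M I r u = enat (h r u)" for r u
  proof -
    have len: "bigraded_length R \<mm> M I a b = sub_length (F b a) (F b (Suc a))" for a b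
      using quotient_length_eq_sub_length[OF F F Fdec, of b a]
      unfolding bigraded_length_def Let_def Feq IM_def by simp
    have col: "(\<Sum>a<Suc r. sub_length (F b a) (F b (Suc a))) = enat (H r b)" for b
      using sub_length_telescope[where F = "F b", OF F Fdec, of "Suc r"] f F0 by (simp add: H_def)
    have "bigraded_hilbert_sum R \<mm> M I r u = (\<Sum>b\<le>u. \<Sum>a<Suc r. sub_length (F b a) (F b (Suc a)))"
      unfolding bigraded_hilbert_sum_def len atLeast0AtMost lessThan_Suc_atMost by (rule sum.swap)
    also have "\<dots> = (\<Sum>b\<le>u. enat (H r b))" by (simp only: col)
    also have "\<dots> = enat (h r u)" unfolding h_def by (induction u) auto
    finally show ?thesis .
  qed
  have columns: "\<exists>T N. degree T \<le> Suc d \<and> (\<forall>r\<ge>N. real (H r u) = poly T (real r))" for u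
  proof -
    obtain T N where T: "degree T \<le> Suc d" "\<forall>n\<ge>N. real (f u n) = poly T (real n)" using fT by blast
    then have "degree (pcompose T [:1, 1:]) \<le> Suc d" "\<forall>r\<ge>N. real (H r u) = poly (pcompose T [:1, 1:]) (real r)"
      by (simp_all add: degree_pcompose H_def poly_pcompose add.commute)
    then show ?thesis by blast
  qed
  have dir: "directional_hilbert R \<mm> M I = (\<lambda>r u. enat (H r u))" by (intro ext H)
  have big: "bigraded_hilbert_sum R \<mm> M I = (\<lambda>r u. enat (h r u))" by (intro ext h)
  show ?thesis
    unfolding directional_multiplicity_def multiplicity_sequence_def dir big assms(5) d Let_def
    using leading_sequences_agree[OF columns h_def, of i] assms(10,11) d by simp
qed

end
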